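(* Fix $\sigma>\frac52$ and let $V=\{V_n\}_{n\in\mathbb Z}$ be a real-valued sequence with $V\in l^1_{2\sigma-1}$. Assume that $V$ is generic in the following sense: for any $s>\frac32$ there is no nonzero solution $u_0\in l^2_{-s}$ of $T_0u_0=0$, and $\langle V,T_0^{-1}1\rangle\neq0$, where $$(T_0f)_n=f_n-\frac12\sum_{m\in\mathbb Z}|n-m|\,V_mf_m .$$ For $\omega\in(0,4)$ let $R(\omega)=\lim_{\varepsilon\downarrow0}(-\Delta+V-\omega-i\varepsilon)^{-1}$ (limit in the norm of $B(\sigma,-\sigma)$). Then there is an operator $R(0)\in B(\sigma,-\sigma)$ such that $$R(\omega)=R(0)+\mathrm O(\sqrt{\omega})$$ in the norm of $B(\sigma,-\sigma)$ for sufficiently small $\omega>0$; that is, there exist $C,\omega_0>0$ with $\|R(\omega)-R(0)\|_{B(\sigma,-\sigma)}\le C\sqrt\omega$ for all $0<\omega<\omega_0$.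
   Context: For a sequence $\phi$ on $\mathbb Z$, $(-\Delta\phi)_n=-(\phi_{n+1}+\phi_{n-1}-2\phi_n)$ and $(V\phi)_n=V_n\phi_n$. For $\sigma\in\mathbb R$, $l^2_\sigma$ is the space of complex sequences on $\mathbb Z$ with $\|u\|_{l^2_\sigma}=\left(\sum_{n}(1+n^2)^{\sigma}|u_n|^2\right)^{1/2}<\infty$, and $l^1_\sigma$ is the space with $\|u\|_{l^1_\sigma}=\sum_{n}(1+n^2)^{\sigma/2}|u_n|<\infty$. $B(\sigma,\sigma')$ denotes the bounded linear operators from $l^2_\sigma$ to $l^2_{\sigma'}$ with the operator norm. For $V$ as in the claim the limit defining $R(\omega)$ exists for each $\omega\in(0,4)$ (limiting absorption principle). $1$ denotes the constant sequence with $1_n=1$ for all $n$, and $\langle\cdot,\cdot\rangle$ is the $l^2$ pairing, $\langle V,u\rangle=\sum_nV_nu_n$ for real $V$. A solution of $T_0u_0=0$ is understood as a sequence for which the series defining $T_0u_0$ converge absolutely. $T_0$ acts boundedly on $l^2_{-\sigma}$ with $T_0-I$ compact, so when its kernel is trivial it is invertible on $l^2_{-\sigma}$, and $T_0^{-1}1$ is the unique $u\in l^2_{-\sigma}$ with $T_0u=1$. *)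

theory Defs
  imports "HOL-Analysis.Analysis"
begin

definition weighted_l1 :: "real \<Rightarrow> (int \<Rightarrow> 'a::real_normed_vector) set" where
  "weighted_l1 \<sigma> =
     {u. (\<lambda>n. (1 + (real_of_int n)\<^sup>2) powr (\<sigma> / 2) * norm (u n)) summable_on UNIV}"

definition weighted_l2 :: "real \<Rightarrow> (int \<Rightarrow> complex) set" where
  "weighted_l2 \<sigma> =
     {u. (\<lambda>n. (1 + (real_of_int n)\<^sup>2) powr \<sigma> * (cmod (u n))\<^sup>2) summable_on UNIV}"

definition l2_norm :: "real \<Rightarrow> (int \<Rightarrow> complex) \<Rightarrow> real" where
  "l2_norm \<sigma> u = sqrt (\<Sum>\<^sub>\<infinity>n. (1 + (real_of_int n)\<^sup>2) powr \<sigma> * (cmod (u n))\<^sup>2)"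

text \<open>Operators are total functions on sequences of which only the values on the domain
  \<open>weighted_l2 \<sigma>\<close> are meaningful.\<close>

type_synonym seq_op = "(int \<Rightarrow> complex) \<Rightarrow> (int \<Rightarrow> complex)"

definition bounded_ops :: "real \<Rightarrow> real \<Rightarrow> seq_op set" where
  "bounded_ops \<sigma> \<tau> =
     {A. (\<forall>u\<in>weighted_l2 \<sigma>. A u \<in> weighted_l2 \<tau>) \<and>
         (\<forall>u\<in>weighted_l2 \<sigma>. \<forall>v\<in>weighted_l2 \<sigma>. A (\<lambda>n. u n + v n) = (\<lambda>n. A u n + A v n)) \<and>
         (\<forall>c. \<forall>u\<in>weighted_l2 \<sigma>. A (\<lambda>n. c * u n) = (\<lambda>n. c * A u n)) \<and>
         (\<exists>C. \<forall>u\<in>weighted_l2 \<sigma>. l2_norm \<tau> (A u) \<le> C * l2_norm \<sigma> u)}"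

text \<open>As for \<^const>\<open>onorm\<close>, the zero sequence contributes \<open>0 / 0 = 0\<close> to the supremum. The value
  is meaningful for operators in \<^const>\<open>bounded_ops\<close> only.\<close>

definition op_norm :: "real \<Rightarrow> real \<Rightarrow> seq_op \<Rightarrow> real" where
  "op_norm \<sigma> \<tau> A = (SUP u\<in>weighted_l2 \<sigma>. l2_norm \<tau> (A u) / l2_norm \<sigma> u)"

definition op_diff :: "seq_op \<Rightarrow> seq_op \<Rightarrow> seq_op" where
  "op_diff A B = (\<lambda>u n. A u n - B u n)"

definition neg_laplacian :: seq_op where
  "neg_laplacian u = (\<lambda>n. - (u (n + 1) + u (n - 1) - 2 * u n))"

definition schroedinger :: "(int \<Rightarrow> real) \<Rightarrow> seq_op" where
  "schroedinger V u = (\<lambda>n. neg_laplacian u n + complex_of_real (V n) * u n)"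

text \<open>The inverse is taken on the unweighted space \<open>l\<^sup>2 = weighted_l2 0\<close>; as an element of
  \<open>bounded_ops \<sigma> (- \<sigma>)\<close> with \<open>\<sigma> \<ge> 0\<close> it is restricted to
  \<open>weighted_l2 \<sigma> \<subseteq> weighted_l2 0 \<subseteq> weighted_l2 (- \<sigma>)\<close>.\<close>

definition resolvent :: "(int \<Rightarrow> real) \<Rightarrow> complex \<Rightarrow> seq_op" where
  "resolvent V z = the_inv_into (weighted_l2 0) (\<lambda>u n. schroedinger V u n - z * u n)"

definition is_boundary_resolvent :: "real \<Rightarrow> (int \<Rightarrow> real) \<Rightarrow> real \<Rightarrow> seq_op \<Rightarrow> bool" where
  "is_boundary_resolvent \<sigma> V \<omega> A \<longleftrightarrow>
     A \<in> bounded_ops \<sigma> (- \<sigma>) \<and>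
     ((\<lambda>\<epsilon>. op_norm \<sigma> (- \<sigma>) (op_diff (resolvent V (Complex \<omega> \<epsilon>)) A)) \<longlongrightarrow> 0) (at_right 0)"

definition T0_summable :: "(int \<Rightarrow> real) \<Rightarrow> (int \<Rightarrow> complex) \<Rightarrow> bool" where
  "T0_summable V f \<longleftrightarrow>
     (\<forall>n. (\<lambda>m. cmod (complex_of_real (\<bar>real_of_int (n - m)\<bar> * V m) * f m)) summable_on UNIV)"

definition T0 :: "(int \<Rightarrow> real) \<Rightarrow> seq_op" where
  "T0 V f = (\<lambda>n. f n - 1/2 * (\<Sum>\<^sub>\<infinity>m. complex_of_real (\<bar>real_of_int (n - m)\<bar> * V m) * f m))"

definition generic_potential :: "real \<Rightarrow> (int \<Rightarrow> real) \<Rightarrow> bool" where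
  "generic_potential \<sigma> V \<longleftrightarrow>
     (\<forall>s>3/2. \<not> (\<exists>u\<in>weighted_l2 (- s). u \<noteq> (\<lambda>_. 0) \<and> T0_summable V u \<and> T0 V u = (\<lambda>_. 0))) \<and>
     (\<Sum>\<^sub>\<infinity>n. complex_of_real (V n) * the_inv_into (weighted_l2 (- \<sigma>)) (T0 V) (\<lambda>_. 1) n) \<noteq> 0"

end

(* The proof replaces Fredholm theory by Jost solutions. Write the spectral parameter as
   z = 2 - l - 1/l with |l| < 1, so that |1 - l|^2 = |l| |z|. The solutions l^n g(n) and l^(-n) h(n) of
   (-Delta + V - z) u = 0 with g, h tending to 1 at plus and minus infinity solve Volterra equations
   which are uniformly contractive for |l| <= 1 in a suitable weight; hence g and h grow at most
   linearly, and their deviation from the values at l = 1 is O(|1 - l| (1 + |n|)^2). The resolvent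
   kernel l^(|n - m| + 1) g(max n m) h(min n m) / W(l) therefore differs from its value at l = 1 by
   O(|1 - l| (1 + |n|)^2 (1 + |m|)^2), provided that the Wronskian W does not vanish at l = 1, and such
   kernels are bounded from weight sigma to weight -sigma because sigma > 5/2. Genericity enters only
   to exclude W(1) = 0. The boundary values R(omega) themselves are reached by letting epsilon tend
   to 0 in the resulting bound. *)

theory Submission imports Defs begin


section \<open>Weighted summation over the integers\<close>

text \<open>The obstacle is uniformity up to |l| = 1, where the free kernel no longer decays and
  convergence has to come from the decay of V. Conjugation by l^n turns the free kernel into a
  polynomial in l that is bounded by the positive part of m - n, and a weight whose logarithm is a
  tail moment of V makes the Volterra operator contractive however large V is. The powers are spent
  as follows. Comparing the kernels at l and at 1 costs (m - n)^2, hence two powers of n and, with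
  the linear growth of g at 1, a third moment of V. The Green kernel is a product of three factors,
  each Lipschitz in l, and the loss is again two powers in each variable. The square root in the
  rate is a branch point: (1 - l)^2 = -l z. Genericity becomes usable because |n - m| is the sum of
  the positive parts of n - m and m - n, so that \<open>T0\<close> is the mean of the two Volterra
  operators at l = 1.\<close>

lemma abs_summable_on_dominated:
  fixes f :: "'a \<Rightarrow> 'b::real_normed_vector"
  assumes "g summable_on A" and "\<And>x. x \<in> A \<Longrightarrow> norm (f x) \<le> g x"
  shows "(\<lambda>x. norm (f x)) summable_on A"
proof (rule Infinite_Sum.abs_summable_on_comparison_test)
  show "(\<lambda>x. norm (g x)) summable_on A"
    using assms(1) summable_on_iff_abs_summable_on_real by blast
  show "norm (f x) \<le> norm (g x)" if "x \<in> A" for x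
    using assms(2)[OF that] by simp
qed

lemma summable_on_dominated:
  fixes f :: "'a \<Rightarrow> 'b::banach"
  assumes "g summable_on A" and "\<And>x. x \<in> A \<Longrightarrow> norm (f x) \<le> g x"
  shows "f summable_on A"
  using abs_summable_summable abs_summable_on_dominated[OF assms] by blast

lemma norm_infsum_dominated:
  fixes f :: "'a \<Rightarrow> 'b::banach"
  assumes "g summable_on A" and "\<And>x. x \<in> A \<Longrightarrow> norm (f x) \<le> g x"
  shows "norm (infsum f A) \<le> infsum g A"
  using norm_infsum_bound[OF abs_summable_on_dominated[OF assms]]
    infsum_mono[OF abs_summable_on_dominated[OF assms] assms(1) assms(2)] by linarith

lemma infsum_diff:
  fixes f g :: "'a \<Rightarrow> 'b::{topological_ab_group_add, t2_space}"
  assumes "f summable_on A" and "g summable_on A"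
  shows "(\<Sum>\<^sub>\<infinity>x\<in>A. f x - g x) = infsum f A - infsum g A"
  using infsum_add[OF assms(1), of "\<lambda>x. - g x"] assms(2)
  by (simp add: infsum_uminus summable_on_uminus)

lemma summable_on_diff:
  fixes f g :: "'a \<Rightarrow> 'b::topological_ab_group_add"
  assumes "f summable_on A" and "g summable_on A"
  shows "(\<lambda>x. f x - g x) summable_on A"
  using summable_on_add[OF assms(1), of "\<lambda>x. - g x"] assms(2) by (simp add: summable_on_uminus)

text \<open>A stand-in for (1 + n^2)^(1/2), comparable with it. Unlike the square root it is
  submultiplicative under addition with constant 1, and it takes integer powers, so most estimates
  become plain arithmetic.\<close>

definition bracket :: "int \<Rightarrow> real" where
  "bracket n = 1 + \<bar>real_of_int n\<bar>"

lemma bracket_ge_1: "1 \<le> bracket n"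
  by (simp add: bracket_def)

lemma bracket_pos: "0 < bracket n"
  by (simp add: bracket_def add_pos_nonneg)

lemma bracket_nonneg [simp]: "0 \<le> bracket n"
  by (simp add: bracket_def)

lemma bracket_uminus [simp]: "bracket (- n) = bracket n"
  by (simp add: bracket_def)

lemma bracket_power_mono: "j \<le> k \<Longrightarrow> bracket n ^ j \<le> bracket n ^ k"
  using bracket_ge_1 power_increasing by blast

lemma nat_diff_le_bracket: "real (nat (m - n)) \<le> bracket n * bracket m"
proof -
  have "real (nat (m - n)) \<le> \<bar>real_of_int m\<bar> + \<bar>real_of_int n\<bar>" by linarith
  also have "\<dots> \<le> bracket n * bracket m" by (simp add: bracket_def algebra_simps)
  finally show ?thesis .
qed

lemma abs_diff_le_bracket: "\<bar>real_of_int (n - m)\<bar> \<le> bracket n * bracket m"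
proof -
  have "\<bar>real_of_int (n - m)\<bar> \<le> \<bar>real_of_int m\<bar> + \<bar>real_of_int n\<bar>" by linarith
  also have "\<dots> \<le> bracket n * bracket m" by (simp add: bracket_def algebra_simps)
  finally show ?thesis .
qed

lemma bracket_add_le: "bracket (m + k) \<le> bracket m * bracket k"
proof -
  have "\<bar>real_of_int (m + k)\<bar> \<le> \<bar>real_of_int m\<bar> + \<bar>real_of_int k\<bar>" by linarith
  moreover have "0 \<le> \<bar>real_of_int k\<bar> * \<bar>real_of_int m\<bar>" by simp
  moreover have "bracket m * bracket k = 1 + \<bar>real_of_int m\<bar> + \<bar>real_of_int k\<bar> + \<bar>real_of_int k\<bar> * \<bar>real_of_int m\<bar>"
    by (simp add: bracket_def algebra_simps)
  ultimately show ?thesis unfolding bracket_def[of "m + k"] by linarith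
qed

section \<open>Volterra equation for the Jost solutions\<close>

text \<open>This is l^k (l^k - l^(-k)) / (l - 1/l) for k > 0: the kernel of variation of constants
  for the free equation, conjugated by l^n. The polynomial form also covers l = 1 and l = -1, and
  \<open>nat k\<close> extends it by 0 to k \<le> 0, so that Volterra sums can run over all
  integers.\<close>

definition jost_kernel :: "complex \<Rightarrow> int \<Rightarrow> complex" where
  "jost_kernel l k = l * (\<Sum>j<nat k. l ^ (2 * j))"

lemma jost_kernel_nonpos [simp]: "k \<le> 0 \<Longrightarrow> jost_kernel l k = 0"
  by (simp add: jost_kernel_def)

lemma jost_kernel_one: "jost_kernel 1 k = of_nat (nat k)"
  by (simp add: jost_kernel_def)

lemma norm_jost_kernel_le:
  assumes "cmod l \<le> 1"
  shows "cmod (jost_kernel l k) \<le> real (nat k)"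
proof -
  have "cmod (\<Sum>j<nat k. l ^ (2 * j)) \<le> (\<Sum>j<nat k. 1)"
    by (rule order.trans[OF norm_sum sum_mono]) (use assms in \<open>simp add: norm_power power_le_one\<close>)
  then have "cmod l * cmod (\<Sum>j<nat k. l ^ (2 * j)) \<le> 1 * real (nat k)"
    by (intro mult_mono) (use assms in auto)
  then show ?thesis by (simp add: jost_kernel_def norm_mult)
qed

lemma norm_power_diff_one_le:
  fixes l :: complex
  assumes "cmod l \<le> 1"
  shows "cmod (l ^ k - 1) \<le> real k * cmod (1 - l)"
  using norm_power_diff[of l 1 k] assms by (simp add: norm_minus_commute)

text \<open>The summands are the odd powers l^(2j+1), each within (2j+1) |1 - l| of 1, and the first
  k odd numbers add up to k^2.\<close>

lemma norm_jost_kernel_diff_le: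
  assumes "cmod l \<le> 1"
  shows "cmod (jost_kernel l k - jost_kernel 1 k) \<le> (real (nat k))\<^sup>2 * cmod (1 - l)"
proof -
  have "jost_kernel l k - jost_kernel 1 k = (\<Sum>j<nat k. l ^ (2 * j + 1) - 1)"
    by (simp add: jost_kernel_def sum_distrib_left sum_subtractf mult.commute)
  also have "cmod \<dots> \<le> (\<Sum>j<nat k. real (2 * j + 1) * cmod (1 - l))"
    by (rule order.trans[OF norm_sum sum_mono]) (rule norm_power_diff_one_le[OF assms])
  also have "\<dots> = (real (nat k))\<^sup>2 * cmod (1 - l)"
  proof -
    have "(\<Sum>j<N. real (2 * j + 1)) = (real N)\<^sup>2" for N
      by (induction N) (auto simp: power2_eq_square algebra_simps)
    then show ?thesis by (simp only: sum_distrib_right[symmetric])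
  qed
  finally show ?thesis .
qed

text \<open>The kernel is a fundamental solution of the conjugated free operator. Here k plays the
  role of m - n, so a step up in n is a step down in k; at k = 0 only
  \<open>jost_kernel l 1 = l\<close> survives.\<close>

lemma jost_kernel_recurrence:
  "l\<^sup>2 * jost_kernel l (k - 1) - (l\<^sup>2 + 1) * jost_kernel l k + jost_kernel l (k + 1)
     = (if k = 0 then l else 0)"
proof (cases "k \<le> 0")
  case True
  then have "k = 0 \<or> k + 1 \<le> 0" by linarith
  moreover have "jost_kernel l 1 = l" by (simp add: jost_kernel_def)
  ultimately show ?thesis using True by auto
next
  case False
  define N where "N = nat (k - 1)"
  have eq: "nat (k - 1) = N" "nat k = Suc N" "nat (k + 1) = Suc (Suc N)"
    using False by (auto simp: N_def)
  define S x where "S = (\<Sum>j<N. l ^ (2 * j))" and "x = l ^ (2 * N)"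
  have "jost_kernel l (k - 1) = l * S" "jost_kernel l k = l * (S + x)"
    "jost_kernel l (k + 1) = l * (S + x + x * l\<^sup>2)"
    unfolding jost_kernel_def eq S_def x_def power2_eq_square by simp_all
  moreover have "l\<^sup>2 * (l * S) - (l\<^sup>2 + 1) * (l * (S + x)) + l * (S + x + x * l\<^sup>2) = 0"
    unfolding power2_eq_square distrib_left distrib_right by (simp add: mult_ac)
  ultimately show ?thesis using False by simp
qed

text \<open>The condition is invariant under reflection, so the theory of the right Jost solution
  can be instantiated at the reflected potential to give the left one.\<close>

locale decaying_potential =
  fixes V :: "int \<Rightarrow> real"
  assumes summable_V: "(\<lambda>m. bracket m ^ 4 * \<bar>V m\<bar>) summable_on UNIV"
begin

section \<open>The exponential tail weight and the uniform contraction\<close>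

lemma summable_V_bracket:
  assumes "k \<le> 4"
  shows "(\<lambda>m. bracket m ^ k * \<bar>V m\<bar>) summable_on UNIV"
  by (rule summable_on_dominated[OF summable_V])
     (use assms bracket_power_mono bracket_pos[THEN less_imp_le] in \<open>auto simp: abs_mult mult_right_mono\<close>)

text \<open>A weight of Bielecki type: the tail lies to the right of n, as does the range of the
  Volterra sum. The factor 2 in the exponent becomes the contraction constant 1/2.\<close>

definition tail_weight :: "int \<Rightarrow> real" where
  "tail_weight n = exp (2 * (\<Sum>\<^sub>\<infinity>m\<in>{n<..}. bracket m ^ 3 * \<bar>V m\<bar>))"

lemma moment_nonneg: "0 \<le> bracket m ^ k * \<bar>V m\<bar>"
  using bracket_pos[of m] by simp

lemma summable_moment_on: "(\<lambda>m. bracket m ^ 3 * \<bar>V m\<bar>) summable_on A"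
  using summable_V_bracket[of 3] summable_on_subset_banach by auto

lemma tail_weight_ge_1: "1 \<le> tail_weight n"
  using infsum_nonneg[of "{n<..}", OF moment_nonneg] by (simp add: tail_weight_def)

lemma tail_weight_bound: "\<exists>E\<ge>1. \<forall>n. tail_weight n \<le> E"
proof (intro exI conjI allI)
  show "1 \<le> exp (2 * (\<Sum>\<^sub>\<infinity>m. bracket m ^ 3 * \<bar>V m\<bar>))"
    using infsum_nonneg[of UNIV, OF moment_nonneg] by simp
  fix n
  have "(\<Sum>\<^sub>\<infinity>m\<in>{n<..}. bracket m ^ 3 * \<bar>V m\<bar>) \<le> (\<Sum>\<^sub>\<infinity>m. bracket m ^ 3 * \<bar>V m\<bar>)"
    by (rule infsum_mono2) (use summable_moment_on moment_nonneg in auto)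
  then show "tail_weight n \<le> exp (2 * (\<Sum>\<^sub>\<infinity>m. bracket m ^ 3 * \<bar>V m\<bar>))"
    by (simp add: tail_weight_def)
qed

text \<open>Discrete form of differentiating the exponential: moving m into the tail multiplies the
  weight by exp (2 a) \<ge> 1 + 2 a, where a is the term at m.\<close>

lemma tail_weight_step:
  "2 * (bracket m ^ 3 * \<bar>V m\<bar>) * tail_weight m \<le> tail_weight (m - 1) - tail_weight m"
proof -
  let ?a = "\<lambda>m. bracket m ^ 3 * \<bar>V m\<bar>"
  have "{m - 1<..} = insert m {m<..}" by auto
  then have "infsum ?a {m - 1<..} = ?a m + infsum ?a {m<..}"
    by (simp add: infsum_insert summable_moment_on)
  then have "tail_weight (m - 1) = exp (2 * ?a m) * tail_weight m"
    by (simp add: tail_weight_def distrib_left exp_add)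
  moreover have "(1 + 2 * ?a m) * tail_weight m \<le> exp (2 * ?a m) * tail_weight m"
    by (intro mult_right_mono exp_ge_add_one_self) (use tail_weight_ge_1[of m] in linarith)
  ultimately show ?thesis by (simp add: algebra_simps)
qed

text \<open>By the preceding inequality the terms are dominated by half the decrements of the
  weight, so finite sums telescope; the remaining end value is positive and is dropped.\<close>

lemma tail_weight_sum:
  fixes n
  defines "f \<equiv> \<lambda>m. bracket m ^ 3 * \<bar>V m\<bar> * tail_weight m"
  shows "f summable_on {n<..}" and "infsum f {n<..} \<le> tail_weight n / 2"
proof -
  obtain E where E: "\<And>n. tail_weight n \<le> E" using tail_weight_bound by blast
  show s: "f summable_on {n<..}"
  proof (rule summable_on_dominated)
    show "(\<lambda>m. bracket m ^ 3 * \<bar>V m\<bar> * E) summable_on {n<..}"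
      by (rule summable_on_cmult_left[OF summable_moment_on])
    show "norm (f m) \<le> bracket m ^ 3 * \<bar>V m\<bar> * E" for m
      using mult_left_mono[OF E moment_nonneg] tail_weight_ge_1[of m] moment_nonneg[of m 3]
      by (simp add: f_def)
  qed
  have fnn: "0 \<le> f m" for m
    using tail_weight_ge_1[of m] moment_nonneg[of m 3] by (simp add: f_def)
  have tele: "(\<Sum>m\<in>{n<..n + int k}. f m) \<le> (tail_weight n - tail_weight (n + int k)) / 2" for k
  proof (induction k)
    case (Suc k)
    have "{n<..n + int (Suc k)} = insert (n + int (Suc k)) {n<..n + int k}" by auto
    with Suc tail_weight_step[of "n + int (Suc k)"] show ?case
      by (simp add: f_def)
  qed simp
  show "infsum f {n<..} \<le> tail_weight n / 2"
  proof (rule infsum_le_finite_sums[OF s])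
    fix F assume F: "finite F" "F \<subseteq> {n<..}"
    obtain N where "F \<subseteq> {..N}" using F(1) by (meson atMost_iff bdd_above_def bdd_above_finite subsetI)
    then have "F \<subseteq> {n<..n + int (nat (N - n))}" using F(2) by force
    then have "sum f F \<le> (\<Sum>m\<in>{n<..n + int (nat (N - n))}. f m)"
      by (intro sum_mono2) (use fnn in auto)
    also have "\<dots> \<le> tail_weight n / 2"
      using tele[of "nat (N - n)"] tail_weight_ge_1[of "n + int (nat (N - n))"]
      by (simp add: field_simps)
    finally show "sum f F \<le> tail_weight n / 2" .
  qed
qed

text \<open>With this weight the Volterra operator, with kernel bounded by \<open>(m - n)\<^sup>+ \<bar>V m\<bar>\<close>, is a
  contraction with constant one half, uniformly in the spectral parameter.\<close>

definition volterra_weight :: "nat \<Rightarrow> int \<Rightarrow> real" where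
  "volterra_weight p n = bracket n ^ p * tail_weight n"

lemma volterra_weight_ge: "bracket n ^ p \<le> volterra_weight p n"
  using mult_left_mono[OF tail_weight_ge_1[of n], of "bracket n ^ p"] bracket_pos[of n]
  by (simp add: volterra_weight_def)

lemma volterra_weight_pos: "0 < volterra_weight p n"
  using volterra_weight_ge[of n p] bracket_pos[of n] by (meson less_le_trans zero_less_power)

lemma volterra_weight_ge_1: "1 \<le> volterra_weight p n"
  using volterra_weight_ge[of n p] bracket_ge_1[of n] one_le_power by (meson order.trans)

text \<open>|m - n| \<open>bracket m ^ p\<close> is at most
  \<open>bracket n * bracket m ^ (p + 1)\<close>, and 1 \<le> p \<le> 2 turns this into
  \<open>bracket n ^ p * bracket m ^ 3\<close>; hence the third moment in the weight. The case p = 1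
  serves existence, p = 2 the comparison with l = 1.\<close>

lemma volterra_weight_sum:
  assumes "1 \<le> p" "p \<le> 2"
  defines "f \<equiv> \<lambda>n m. real (nat (m - n)) * \<bar>V m\<bar> * volterra_weight p m"
  shows "f n summable_on UNIV" and "infsum (f n) UNIV \<le> volterra_weight p n / 2"
proof -
  let ?g = "\<lambda>m. bracket n ^ p * (bracket m ^ 3 * \<bar>V m\<bar> * tail_weight m)"
  have gs: "?g summable_on {n<..}" by (rule summable_on_cmult_right[OF tail_weight_sum(1)])
  have le: "norm (f n m) \<le> ?g m" for m
  proof -
    have "real (nat (m - n)) * bracket m ^ p \<le> (bracket n * bracket m) * bracket m ^ p"
      by (intro mult_right_mono nat_diff_le_bracket) (use bracket_pos[of m] in simp)
    also have "\<dots> = bracket n ^ 1 * bracket m ^ (p + 1)" by simp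
    also have "\<dots> \<le> bracket n ^ p * bracket m ^ 3"
      by (intro mult_mono bracket_power_mono) (use assms bracket_pos[of m] bracket_pos[of n] in auto)
    finally have "real (nat (m - n)) * bracket m ^ p * (\<bar>V m\<bar> * tail_weight m)
        \<le> bracket n ^ p * bracket m ^ 3 * (\<bar>V m\<bar> * tail_weight m)"
      by (rule mult_right_mono) (use tail_weight_ge_1[of m] in auto)
    then show ?thesis
      using bracket_pos[of m] tail_weight_ge_1[of m]
      by (simp add: f_def volterra_weight_def abs_mult mult_ac)
  qed
  \<comment> \<open>Since \<open>nat (m - n)\<close> is 0 for m \<le> n, only the tail beyond n
    contributes.\<close>
  have eq: "infsum (f n) UNIV = infsum (f n) {n<..}" "f n summable_on UNIV \<longleftrightarrow> f n summable_on {n<..}"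
    by (rule infsum_cong_neutral summable_on_cong_neutral; auto simp: f_def)+
  show "f n summable_on UNIV"
    unfolding eq by (rule summable_on_dominated[OF gs le])
  have "infsum (f n) {n<..} \<le> infsum ?g {n<..}"
    using norm_infsum_dominated[OF gs le] by simp
  also have "\<dots> = bracket n ^ p * infsum (\<lambda>m. bracket m ^ 3 * \<bar>V m\<bar> * tail_weight m) {n<..}"
    by (rule infsum_cmult_right) (rule tail_weight_sum(1))
  also have "\<dots> \<le> bracket n ^ p * (tail_weight n / 2)"
    by (intro mult_left_mono tail_weight_sum(2)) (use bracket_pos[of n] in simp)
  finally show "infsum (f n) UNIV \<le> volterra_weight p n / 2"
    by (simp add: eq volterra_weight_def)
qed

text \<open>With S the supremum of the quotient of \<open>e\<close> by the weight, the contraction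
  gives S \<le> B + S / 2. The a priori bound makes S finite, which allows S / 2 to be subtracted;
  its constant does not reach the conclusion.\<close>

lemma volterra_gronwall:
  fixes e :: "int \<Rightarrow> real"
  assumes p: "1 \<le> p" "p \<le> 2"
    and apriori: "\<And>n. 0 \<le> e n" "\<And>n. e n \<le> C * volterra_weight p n"
    and ineq: "\<And>n. e n \<le> B * volterra_weight p n + (\<Sum>\<^sub>\<infinity>m. real (nat (m - n)) * \<bar>V m\<bar> * e m)"
  shows "e n \<le> 2 * B * volterra_weight p n"
proof -
  let ?w = "volterra_weight p"
  define S where "S = (SUP n. e n / ?w n)"
  have bdd: "bdd_above (range (\<lambda>n. e n / ?w n))"
    by (rule bdd_aboveI[of _ C]) (auto simp: divide_le_eq volterra_weight_pos apriori)
  have eS: "e n \<le> S * ?w n" for n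
    using cSUP_upper[OF _ bdd, of n] volterra_weight_pos[of p n] by (simp add: S_def divide_le_eq)
  have "e n / ?w n \<le> B + S / 2" for n
  proof -
    have s: "(\<lambda>m. S * (real (nat (m - n)) * \<bar>V m\<bar> * ?w m)) summable_on UNIV"
      by (rule summable_on_cmult_right[OF volterra_weight_sum(1)[OF p]])
    have "(\<Sum>\<^sub>\<infinity>m. real (nat (m - n)) * \<bar>V m\<bar> * e m) \<le> norm (\<Sum>\<^sub>\<infinity>m. real (nat (m - n)) * \<bar>V m\<bar> * e m)"
      by simp
    also have "\<dots> \<le> (\<Sum>\<^sub>\<infinity>m. S * (real (nat (m - n)) * \<bar>V m\<bar> * ?w m))"
    proof (rule norm_infsum_dominated[OF s])
      fix m
      have "real (nat (m - n)) * \<bar>V m\<bar> * e m \<le> real (nat (m - n)) * \<bar>V m\<bar> * (S * ?w m)"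
        by (intro mult_left_mono eS) simp
      then show "norm (real (nat (m - n)) * \<bar>V m\<bar> * e m) \<le> S * (real (nat (m - n)) * \<bar>V m\<bar> * ?w m)"
        using apriori(1)[of m] by (simp add: mult_ac)
    qed
    also have "\<dots> = S * (\<Sum>\<^sub>\<infinity>m. real (nat (m - n)) * \<bar>V m\<bar> * ?w m)"
      by (rule infsum_cmult_right) (rule volterra_weight_sum(1)[OF p])
    also have "\<dots> \<le> S * (?w n / 2)"
    proof (rule mult_left_mono[OF volterra_weight_sum(2)[OF p]])
      have "0 \<le> S * ?w n" using eS[of n] apriori(1)[of n] by linarith
      then show "0 \<le> S" using volterra_weight_pos[of p n] by (simp add: zero_le_mult_iff)
    qed
    finally have "e n \<le> (B + S / 2) * ?w n" using ineq[of n] by (simp add: algebra_simps)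
    then show ?thesis using volterra_weight_pos[of p n] by (simp add: divide_le_eq)
  qed
  then have "S \<le> B + S / 2" unfolding S_def by (intro cSUP_least) auto
  then have "S \<le> 2 * B" by simp
  then have "S * ?w n \<le> 2 * B * ?w n" by (intro mult_right_mono) (use volterra_weight_pos[of p n] in auto)
  with eS[of n] show ?thesis by linarith
qed

section \<open>Jost solutions: existence, difference equation, dependence on l\<close>

lemma summable_jost:
  assumes "cmod l \<le> 1" and "\<And>m. cmod (u m) \<le> C * volterra_weight 1 m"
  shows "(\<lambda>m. jost_kernel l (m - n) * of_real (V m) * u m) summable_on UNIV"
    and "cmod (\<Sum>\<^sub>\<infinity>m. jost_kernel l (m - n) * of_real (V m) * u m) \<le> C * volterra_weight 1 n / 2"
proof -
  let ?g = "\<lambda>m. C * (real (nat (m - n)) * \<bar>V m\<bar> * volterra_weight 1 m)"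
  have s: "?g summable_on UNIV"
    by (rule summable_on_cmult_right[OF volterra_weight_sum(1)]) auto
  have le: "cmod (jost_kernel l (m - n) * of_real (V m) * u m) \<le> ?g m" for m
  proof -
    have "cmod (jost_kernel l (m - n)) * \<bar>V m\<bar> * cmod (u m)
        \<le> real (nat (m - n)) * \<bar>V m\<bar> * (C * volterra_weight 1 m)"
      by (intro mult_mono norm_jost_kernel_le assms) auto
    then show ?thesis by (simp add: norm_mult mult_ac)
  qed
  show "(\<lambda>m. jost_kernel l (m - n) * of_real (V m) * u m) summable_on UNIV"
    by (rule summable_on_dominated[OF s le])
  have "0 \<le> C * volterra_weight 1 0" using assms(2)[of 0] norm_ge_zero order.trans by blast
  then have C: "0 \<le> C" using volterra_weight_pos[of 1 0] by (simp add: zero_le_mult_iff)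
  have "cmod (\<Sum>\<^sub>\<infinity>m. jost_kernel l (m - n) * of_real (V m) * u m) \<le> infsum ?g UNIV"
    by (rule norm_infsum_dominated[OF s le])
  also have "\<dots> = C * (\<Sum>\<^sub>\<infinity>m. real (nat (m - n)) * \<bar>V m\<bar> * volterra_weight 1 m)"
    by (rule infsum_cmult_right) (rule volterra_weight_sum(1), auto)
  also have "\<dots> \<le> C * (volterra_weight 1 n / 2)"
    by (intro mult_left_mono volterra_weight_sum(2) C) auto
  finally show "cmod (\<Sum>\<^sub>\<infinity>m. jost_kernel l (m - n) * of_real (V m) * u m) \<le> C * volterra_weight 1 n / 2"
    by simp
qed

text \<open>The growth bound belongs to the notion because it makes the series converge;
  \<open>infsum\<close> would be 0 otherwise. The factor 2 is reproduced by the equation: a sequence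
  below 2 w is mapped below 1 + w, and 1 \<le> w.\<close>

definition is_jost :: "complex \<Rightarrow> (int \<Rightarrow> complex) \<Rightarrow> bool" where
  "is_jost l g \<longleftrightarrow>
     (\<forall>n. cmod (g n) \<le> 2 * volterra_weight 1 n) \<and>
     (\<forall>n. g n = 1 + (\<Sum>\<^sub>\<infinity>m. jost_kernel l (m - n) * of_real (V m) * g m))"

lemma is_jostD:
  assumes "is_jost l g"
  shows "cmod (g n) \<le> 2 * volterra_weight 1 n"
    and "g n = 1 + (\<Sum>\<^sub>\<infinity>m. jost_kernel l (m - n) * of_real (V m) * g m)"
  using assms unfolding is_jost_def by blast+

text \<open>Picard iteration from 0: successive differences shrink by 1/2 relative to the weight, so
  the iterates converge pointwise at a geometric rate with a weighted error bound.\<close>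

lemma is_jost_exists:
  assumes l: "cmod l \<le> 1"
  shows "\<exists>g. is_jost l g"
proof -
  let ?w = "volterra_weight 1"
  define K where "K u n = (\<Sum>\<^sub>\<infinity>m. jost_kernel l (m - n) * of_real (V m) * u m)" for u n
  have K_bound: "cmod (K u n) \<le> C * ?w n / 2" if "\<And>m. cmod (u m) \<le> C * ?w m" for u C n
    unfolding K_def by (rule summable_jost(2)[OF l that])
  have K_diff: "K (\<lambda>m. u m - v m) n = K u n - K v n"
    if "\<And>m. cmod (u m) \<le> C * ?w m" "\<And>m. cmod (v m) \<le> D * ?w m" for u v C D n
    using infsum_diff[OF summable_jost(1)[OF l that(1), of n] summable_jost(1)[OF l that(2), of n]]
    by (simp add: K_def right_diff_distrib)
  define u where "u k = ((\<lambda>u n. 1 + K u n) ^^ k) (\<lambda>_. 0)" for k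
  have u_Suc: "u (Suc k) n = 1 + K (u k) n" for k n by (simp add: u_def)
  have u_bound: "cmod (u k m) \<le> 2 * ?w m" for k m
  proof (induction k arbitrary: m)
    case 0
    then show ?case using volterra_weight_pos[of 1 m] by (simp add: u_def)
  next
    case (Suc k)
    have "cmod (u (Suc k) m) \<le> 1 + cmod (K (u k) m)"
      unfolding u_Suc by (metis norm_one norm_triangle_ineq)
    then show ?case using K_bound[OF Suc, of m] volterra_weight_ge_1[of 1 m] by linarith
  qed
  have step: "cmod (u (Suc k) m - u k m) \<le> (1/2) ^ k * ?w m" for k m
  proof (induction k arbitrary: m)
    case 0
    then show ?case using volterra_weight_ge_1[of 1 m] by (simp add: u_def K_def)
  next
    case (Suc k)
    have "u (Suc (Suc k)) m - u (Suc k) m = K (\<lambda>m. u (Suc k) m - u k m) m"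
      using K_diff[of "u (Suc k)" 2 "u k" 2 m, OF u_bound u_bound] u_Suc[of "Suc k" m] u_Suc[of k m] by simp
    then show ?case using K_bound[OF Suc, of m] by simp
  qed
  define g where "g m = (\<Sum>k. u (Suc k) m - u k m)" for m
  have tail: "cmod (g m - u k m) \<le> 2 * (1/2) ^ k * ?w m" for k m
  proof -
    have sw: "(\<lambda>j. (1/2) ^ (j + k) * ?w m) sums (2 * (1/2) ^ k * ?w m)"
      using sums_mult2[OF geometric_sums[of "1/2 :: real"], of "(1/2) ^ k * ?w m"]
      by (simp add: power_add mult_ac)
    have s: "summable (\<lambda>k. u (Suc k) m - u k m)"
      by (rule summable_comparison_test'[OF summable_mult2[OF summable_geometric]])
         (use step in auto)
    have "g m - u k m = (\<Sum>j. u (Suc (j + k)) m - u (j + k) m)"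
      using suminf_minus_initial_segment[OF s, of k] sum_lessThan_telescope[of "\<lambda>k. u k m" k]
      by (simp add: g_def u_def)
    also have "cmod \<dots> \<le> (\<Sum>j. (1/2) ^ (j + k) * ?w m)"
      by (rule norm_suminf_le[OF step]) (use sw in \<open>simp add: sums_iff\<close>)
    finally show ?thesis using sw by (simp add: sums_iff)
  qed
  have g_bound: "cmod (g m) \<le> 2 * ?w m" for m
    using tail[of m 0] by (simp add: u_def)
  moreover have "g n = 1 + K g n" for n
  proof -
    \<comment> \<open>The defect of the equation is the error of iterate k + 1 minus K applied to
      the error of iterate k. Both are of order 2^(-k), which justifies the limit under the
      sum.\<close>
    have "cmod (g n - (1 + K g n)) \<le> 2 * ?w n * (1/2) ^ k" for k
    proof -
      have "K (\<lambda>m. g m - u k m) n = K g n - K (u k) n"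
        using K_diff[OF g_bound u_bound] by simp
      then have eq: "g n - (1 + K g n) = (g n - u (Suc k) n) - K (\<lambda>m. g m - u k m) n"
        by (simp add: u_Suc)
      have "cmod (K (\<lambda>m. g m - u k m) n) \<le> (1/2) ^ k * ?w n"
        using K_bound[OF tail, of k n] by simp
      then show ?thesis
        unfolding eq using tail[of n "Suc k"] norm_triangle_ineq4[of "g n - u (Suc k) n" "K (\<lambda>m. g m - u k m) n"]
        by (simp add: mult_ac)
    qed
    moreover have "(\<lambda>k. 2 * ?w n * (1/2) ^ k) \<longlonglongrightarrow> 2 * ?w n * 0"
      by (intro tendsto_mult tendsto_const LIMSEQ_power_zero) simp
    ultimately have "cmod (g n - (1 + K g n)) \<le> 0"
      by (intro LIMSEQ_le_const[of "\<lambda>k. 2 * ?w n * (1/2) ^ k"]) auto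
    then show ?thesis by simp
  qed
  ultimately show ?thesis unfolding is_jost_def K_def by blast
qed

lemma is_jost_bound: "\<exists>C>0. \<forall>l g n. is_jost l g \<longrightarrow> cmod (g n) \<le> C * bracket n"
proof -
  obtain E where E: "E \<ge> 1" "\<And>n. tail_weight n \<le> E" using tail_weight_bound by blast
  have "cmod (g n) \<le> 2 * E * bracket n" if "is_jost l g" for l g n
  proof -
    have "2 * volterra_weight 1 n \<le> 2 * E * bracket n"
      using mult_left_mono[OF E(2)[of n], of "bracket n"] bracket_pos[of n]
      by (simp add: volterra_weight_def mult_ac)
    with is_jostD(1)[OF that, of n] show ?thesis by linarith
  qed
  then show ?thesis by (intro exI[of _ "2 * E"]) (use E(1) in auto)
qed

text \<open>The coefficients l^2, -(l^2 + 1), 1 add up to 0, so the constant 1 in the Volterra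
  equation is annihilated; under the sum they turn the kernel into l times a delta at m = n.\<close>

lemma is_jost_recurrence:
  assumes l: "cmod l \<le> 1" and g: "is_jost l g"
  shows "l\<^sup>2 * g (n + 1) - (l\<^sup>2 + 1) * g n + g (n - 1) = l * of_real (V n) * g n"
proof -
  let ?k = "\<lambda>n m. jost_kernel l (m - n) * of_real (V m) * g m"
  have hs: "(?k n has_sum (g n - 1)) UNIV" for n
  proof -
    have "infsum (?k n) UNIV = g n - 1" using is_jostD(2)[OF g, of n] by simp
    then show ?thesis using has_sum_infsum[OF summable_jost(1)[OF l is_jostD(1)[OF g], of n]] by argo
  qed
  have "((\<lambda>m. l\<^sup>2 * ?k (n + 1) m + - (l\<^sup>2 + 1) * ?k n m + ?k (n - 1) m) has_sum
      (l\<^sup>2 * (g (n + 1) - 1) + - (l\<^sup>2 + 1) * (g n - 1) + (g (n - 1) - 1))) UNIV"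
    by (intro has_sum_add has_sum_cmult_right hs)
  moreover have "l\<^sup>2 * ?k (n + 1) m + - (l\<^sup>2 + 1) * ?k n m + ?k (n - 1) m
      = (if m = n then l * of_real (V n) * g n else 0)" for m
  proof -
    have "l\<^sup>2 * ?k (n + 1) m + - (l\<^sup>2 + 1) * ?k n m + ?k (n - 1) m
      = (l\<^sup>2 * jost_kernel l (m - n - 1) - (l\<^sup>2 + 1) * jost_kernel l (m - n) + jost_kernel l (m - n + 1))
        * of_real (V m) * g m"
      by (simp add: algebra_simps)
    then show ?thesis unfolding jost_kernel_recurrence by simp
  qed
  ultimately have "((\<lambda>m. if m = n then l * of_real (V n) * g n else 0) has_sum
      (l\<^sup>2 * (g (n + 1) - 1) + - (l\<^sup>2 + 1) * (g n - 1) + (g (n - 1) - 1))) UNIV"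
    by simp
  moreover have "((\<lambda>m. if m = n then l * of_real (V n) * g n else 0) has_sum (l * of_real (V n) * g n)) UNIV"
    by (rule has_sum_finite_neutralI[of "{n}"]) auto
  ultimately have "l\<^sup>2 * (g (n + 1) - 1) + - (l\<^sup>2 + 1) * (g n - 1) + (g (n - 1) - 1) = l * of_real (V n) * g n"
    using has_sum_unique by blast
  then show ?thesis by (simp add: algebra_simps)
qed

text \<open>The difference of the two equations is a source, the kernel difference applied to
  \<open>g1\<close>, plus the Volterra operator at l applied to \<open>g - g1\<close>. The source is
  O(|1 - l|) times \<open>(bracket n)\<^sup>2\<close>, and the Gronwall estimate with p = 2 absorbs
  the rest.\<close>

lemma is_jost_diff_bound:
  "\<exists>C>0. \<forall>l g g1 n. cmod l \<le> 1 \<longrightarrow> is_jost l g \<longrightarrow> is_jost 1 g1 \<longrightarrow>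
     cmod (g n - g1 n) \<le> C * cmod (1 - l) * (bracket n)\<^sup>2"
proof -
  obtain C where C: "C > 0" "\<And>l g n. is_jost l g \<Longrightarrow> cmod (g n) \<le> C * bracket n"
    using is_jost_bound by blast
  obtain E where E: "E \<ge> 1" "\<And>n. tail_weight n \<le> E" using tail_weight_bound by blast
  define M where "M = (\<Sum>\<^sub>\<infinity>m. bracket m ^ 3 * \<bar>V m\<bar>)"
  have M: "0 \<le> M" unfolding M_def by (rule infsum_nonneg) (rule moment_nonneg)
  have "cmod (g n - g1 n) \<le> (2 * (M * C + 1) * E) * cmod (1 - l) * (bracket n)\<^sup>2"
    if l: "cmod l \<le> 1" and g: "is_jost l g" and g1: "is_jost 1 g1" for l g g1 n
  proof -
    define e where "e n = cmod (g n - g1 n)" for n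
    let ?k = "\<lambda>l g n m. jost_kernel l (m - n) * of_real (V m) * g m"
    have sk: "?k l g n summable_on UNIV" "?k 1 g1 n summable_on UNIV" "?k l g1 n summable_on UNIV" for n
      using summable_jost(1)[OF l is_jostD(1)[OF g]] summable_jost(1)[OF l is_jostD(1)[OF g1]]
        summable_jost(1)[OF _ is_jostD(1)[OF g1], of 1] by auto
    have e_le: "e n \<le> 4 * volterra_weight 2 n" for n
    proof -
      have "volterra_weight 1 n \<le> volterra_weight 2 n"
        unfolding volterra_weight_def using bracket_power_mono[of 1 2 n] tail_weight_ge_1[of n]
        by (intro mult_right_mono) auto
      then show ?thesis
        using norm_triangle_ineq4[of "g n" "g1 n"] is_jostD(1)[OF g, of n] is_jostD(1)[OF g1, of n]
        by (simp add: e_def)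
    qed
    have ineq: "e n \<le> (M * C * cmod (1 - l)) * volterra_weight 2 n
        + (\<Sum>\<^sub>\<infinity>m. real (nat (m - n)) * \<bar>V m\<bar> * e m)" for n
    proof -
      let ?A = "\<Sum>\<^sub>\<infinity>m. ?k l g1 n m - ?k 1 g1 n m" and ?B = "\<Sum>\<^sub>\<infinity>m. ?k l g n m - ?k l g1 n m"
      have "g n - g1 n = ?A + ?B"
        using is_jostD(2)[OF g, of n] is_jostD(2)[OF g1, of n]
        by (simp add: infsum_diff sk)
      then have "e n \<le> cmod ?A + cmod ?B" unfolding e_def by (simp add: norm_triangle_ineq)
      moreover have "cmod ?A \<le> M * C * cmod (1 - l) * volterra_weight 2 n"
      proof -
        let ?g = "\<lambda>m. ((bracket n)\<^sup>2 * cmod (1 - l) * C) * (bracket m ^ 3 * \<bar>V m\<bar>)"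
        have s: "?g summable_on UNIV" by (rule summable_on_cmult_right[OF summable_moment_on])
        have "cmod ?A \<le> infsum ?g UNIV"
        proof (rule norm_infsum_dominated[OF s])
          fix m
          have "(real (nat (m - n)))\<^sup>2 \<le> (bracket n * bracket m)\<^sup>2"
            by (intro power_mono nat_diff_le_bracket) simp
          then have "(real (nat (m - n)))\<^sup>2 * cmod (1 - l) \<le> (bracket n * bracket m)\<^sup>2 * cmod (1 - l)"
            by (rule mult_right_mono) simp
          then have 1: "cmod (jost_kernel l (m - n) - jost_kernel 1 (m - n)) \<le> (bracket n * bracket m)\<^sup>2 * cmod (1 - l)"
            using norm_jost_kernel_diff_le[OF l, of "m - n"] by linarith
          have "cmod (?k l g1 n m - ?k 1 g1 n m)
              = cmod (jost_kernel l (m - n) - jost_kernel 1 (m - n)) * \<bar>V m\<bar> * cmod (g1 m)"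
            by (simp add: norm_mult flip: left_diff_distrib)
          also have "\<dots> \<le> ((bracket n * bracket m)\<^sup>2 * cmod (1 - l)) * \<bar>V m\<bar> * (C * bracket m)"
            by (intro mult_mono 1 C(2)[OF g1]) auto
          also have "\<dots> = ?g m"
            by (simp add: power2_eq_square power3_eq_cube mult_ac)
          finally show "cmod (?k l g1 n m - ?k 1 g1 n m) \<le> ?g m" .
        qed
        also have "\<dots> = (bracket n)\<^sup>2 * cmod (1 - l) * C * M"
          unfolding M_def by (rule infsum_cmult_right) (rule summable_moment_on)
        also have "\<dots> = M * C * cmod (1 - l) * (bracket n)\<^sup>2" by simp
        also have "\<dots> \<le> M * C * cmod (1 - l) * volterra_weight 2 n"
          by (intro mult_left_mono volterra_weight_ge) (use M C(1) in auto)
        finally show ?thesis .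
      qed
      moreover have "cmod ?B \<le> (\<Sum>\<^sub>\<infinity>m. real (nat (m - n)) * \<bar>V m\<bar> * e m)"
      proof (rule norm_infsum_dominated)
        show "(\<lambda>m. real (nat (m - n)) * \<bar>V m\<bar> * e m) summable_on UNIV"
        proof (rule summable_on_dominated)
          show "(\<lambda>m. 4 * (real (nat (m - n)) * \<bar>V m\<bar> * volterra_weight 2 m)) summable_on UNIV"
            by (rule summable_on_cmult_right[OF volterra_weight_sum(1)]) auto
          fix m
          have "real (nat (m - n)) * \<bar>V m\<bar> * e m \<le> real (nat (m - n)) * \<bar>V m\<bar> * (4 * volterra_weight 2 m)"
            by (intro mult_left_mono e_le) simp
          then show "norm (real (nat (m - n)) * \<bar>V m\<bar> * e m) \<le> 4 * (real (nat (m - n)) * \<bar>V m\<bar> * volterra_weight 2 m)"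
            by (simp add: e_def mult_ac)
        qed
        fix m
        have "cmod (?k l g n m - ?k l g1 n m) = cmod (jost_kernel l (m - n)) * \<bar>V m\<bar> * e m"
          by (simp add: e_def norm_mult flip: right_diff_distrib)
        also have "\<dots> \<le> real (nat (m - n)) * \<bar>V m\<bar> * e m"
          by (intro mult_right_mono norm_jost_kernel_le l) (auto simp: e_def)
        finally show "cmod (?k l g n m - ?k l g1 n m) \<le> real (nat (m - n)) * \<bar>V m\<bar> * e m" .
      qed
      ultimately show ?thesis by linarith
    qed
    have "e n \<le> 2 * (M * C * cmod (1 - l)) * volterra_weight 2 n"
      by (rule volterra_gronwall[where p = 2, OF _ _ _ e_le ineq]) (auto simp: e_def)
    \<comment> \<open>The added 1 keeps the constant positive when V vanishes identically and M =
      0.\<close>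
    also have "\<dots> \<le> 2 * ((M * C + 1) * cmod (1 - l)) * ((bracket n)\<^sup>2 * E)"
      unfolding volterra_weight_def using M C(1) E(2)[of n] tail_weight_ge_1[of n] bracket_pos[of n]
      by (intro mult_mono) auto
    finally show ?thesis by (simp add: e_def algebra_simps)
  qed
  moreover have "0 < 2 * (M * C + 1) * E" using M C(1) E(1) by (simp add: add_nonneg_pos)
  ultimately show ?thesis by blast
qed

end


section \<open>Operators between the weighted spaces\<close>

lemma one_plus_square_pos: "0 < 1 + (real_of_int n)\<^sup>2"
  by (simp add: add_pos_nonneg)

lemma bracket_square_le: "(bracket n)\<^sup>2 \<le> 2 * (1 + (real_of_int n)\<^sup>2)"
proof -
  have "0 \<le> (1 - \<bar>real_of_int n\<bar>)\<^sup>2" by simp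
  then show ?thesis by (simp add: bracket_def power2_eq_square algebra_simps)
qed

lemma summable_on_int_of_nat:
  fixes f :: "int \<Rightarrow> real"
  assumes "summable (\<lambda>n. f (int n))" "summable (\<lambda>n. f (- int n))" and "\<And>n. 0 \<le> f n"
  shows "f summable_on UNIV"
proof -
  have "f summable_on range int" "f summable_on range (\<lambda>n. - int n)"
    using assms by (auto simp: summable_on_reindex o_def inj_on_def intro!: summable_nonneg_imp_summable_on)
  then have "f summable_on (range int \<union> range (\<lambda>n. - int n))"
    by (rule summable_on_union)
  also have "range int \<union> range (\<lambda>n. - int n) = UNIV"
    by (auto simp: image_iff) (metis int_cases2)
  finally show ?thesis .
qed

lemma bracket_powr_summable:
  assumes "s < -1"
  shows "(\<lambda>n. bracket n powr s) summable_on UNIV"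
proof -
  have "summable (\<lambda>n. real (Suc n) powr s)"
    using assms by (subst summable_Suc_iff) (simp add: summable_real_powr_iff)
  then show ?thesis by (intro summable_on_int_of_nat) (simp_all add: bracket_def)
qed

text \<open>The terms are of order |n|^(4 - 2 \<sigma>), and 4 - 2 \<sigma> < -1 is exactly \<sigma>
  > 5/2.\<close>

lemma bracket_moment_summable:
  assumes "\<sigma> > 5/2"
  shows "(\<lambda>n. bracket n ^ 4 * (1 + (real_of_int n)\<^sup>2) powr (- \<sigma>)) summable_on UNIV"
proof (rule summable_on_dominated)
  show "(\<lambda>n. 2 powr \<sigma> * bracket n powr (4 - 2 * \<sigma>)) summable_on UNIV"
    by (rule summable_on_cmult_right[OF bracket_powr_summable]) (use assms in simp)
  fix n
  have "(1 + (real_of_int n)\<^sup>2) powr (- \<sigma>) \<le> ((bracket n)\<^sup>2 / 2) powr (- \<sigma>)"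
    using bracket_square_le[of n] bracket_pos[of n] assms by (intro powr_mono2') auto
  also have "\<dots> = 2 powr \<sigma> * bracket n powr (- 2 * \<sigma>)"
    using bracket_pos[of n]
    by (simp add: powr_divide powr_minus divide_simps powr_powr flip: powr_numeral)
  finally have "bracket n ^ 4 * (1 + (real_of_int n)\<^sup>2) powr (- \<sigma>)
      \<le> bracket n ^ 4 * (2 powr \<sigma> * bracket n powr (- 2 * \<sigma>))"
    using bracket_pos[of n] by (intro mult_left_mono) auto
  also have "\<dots> = 2 powr \<sigma> * bracket n powr (4 - 2 * \<sigma>)"
    using bracket_pos[of n] powr_add[of "bracket n" 4 "- 2 * \<sigma>"] by simp
  finally show "norm (bracket n ^ 4 * (1 + (real_of_int n)\<^sup>2) powr (- \<sigma>)) \<le> 2 powr \<sigma> * bracket n powr (4 - 2 * \<sigma>)"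
    using bracket_pos[of n] by simp
qed

text \<open>The norm of the sequence \<open>(bracket n)\<^sup>2\<close> in weight -\<sigma>. Its
  square bounds the norm of the rank-one kernel
  \<open>(bracket n)\<^sup>2 * (bracket m)\<^sup>2\<close> from weight \<sigma> to weight
  -\<sigma>.\<close>

definition moment_const :: "real \<Rightarrow> real" where
  "moment_const \<sigma> = sqrt (\<Sum>\<^sub>\<infinity>n. bracket n ^ 4 * (1 + (real_of_int n)\<^sup>2) powr (- \<sigma>))"

lemma moment_const_nonneg: "0 \<le> moment_const \<sigma>"
  unfolding moment_const_def by (intro real_sqrt_ge_zero infsum_nonneg) (simp add: bracket_pos less_imp_le)

lemma l2_norm_nonneg: "0 \<le> l2_norm \<sigma> u"
  unfolding l2_norm_def by (intro real_sqrt_ge_zero infsum_nonneg) simp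

text \<open>Moving the weight into the sequence makes the weighted norm a supremum of
  \<open>L2_set\<close> over finite sets, where the Minkowski and Cauchy-Schwarz inequalities are
  available.\<close>

definition weighted_abs :: "real \<Rightarrow> (int \<Rightarrow> complex) \<Rightarrow> int \<Rightarrow> real" where
  "weighted_abs \<sigma> u n = (1 + (real_of_int n)\<^sup>2) powr (\<sigma> / 2) * cmod (u n)"

lemma weighted_abs_nonneg: "0 \<le> weighted_abs \<sigma> u n"
  by (simp add: weighted_abs_def)

lemma weighted_abs_square:
  "(weighted_abs \<sigma> u n)\<^sup>2 = (1 + (real_of_int n)\<^sup>2) powr \<sigma> * (cmod (u n))\<^sup>2"
  using one_plus_square_pos[of n]
  by (simp add: weighted_abs_def power_mult_distrib power2_eq_square flip: powr_add)

lemma weighted_l2_iff: "u \<in> weighted_l2 \<sigma> \<longleftrightarrow> (\<lambda>n. (weighted_abs \<sigma> u n)\<^sup>2) summable_on UNIV"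
  by (simp add: weighted_l2_def weighted_abs_square)

lemma l2_norm_eq: "l2_norm \<sigma> u = sqrt (\<Sum>\<^sub>\<infinity>n. (weighted_abs \<sigma> u n)\<^sup>2)"
  by (simp add: l2_norm_def weighted_abs_square)

lemma L2_set_weighted_le:
  assumes "u \<in> weighted_l2 \<sigma>" "finite F"
  shows "L2_set (weighted_abs \<sigma> u) F \<le> l2_norm \<sigma> u"
  unfolding L2_set_def l2_norm_eq
  by (intro real_sqrt_le_mono finite_sum_le_infsum) (use assms in \<open>auto simp: weighted_l2_iff\<close>)

lemma weighted_l2I:
  assumes "\<And>F. finite F \<Longrightarrow> L2_set (weighted_abs \<sigma> u) F \<le> B"
  shows "u \<in> weighted_l2 \<sigma>" and "l2_norm \<sigma> u \<le> B"
proof -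
  have B: "0 \<le> B" using assms[of "{}"] by simp
  have le: "(\<Sum>n\<in>F. (weighted_abs \<sigma> u n)\<^sup>2) \<le> B\<^sup>2" if "finite F" for F
    using assms[OF that] B by (simp add: L2_set_def real_sqrt_le_iff' sum_nonneg)
  have "(\<lambda>n. (weighted_abs \<sigma> u n)\<^sup>2) summable_on UNIV"
    by (rule nonneg_bdd_above_summable_on) (auto intro!: bdd_aboveI[of _ "B\<^sup>2"] le)
  moreover from this have "(\<Sum>\<^sub>\<infinity>n. (weighted_abs \<sigma> u n)\<^sup>2) \<le> B\<^sup>2"
    by (rule infsum_le_finite_sums) (use le in auto)
  ultimately show "u \<in> weighted_l2 \<sigma>" "l2_norm \<sigma> u \<le> B"
    using B by (auto simp: weighted_l2_iff l2_norm_eq intro: real_le_lsqrt infsum_nonneg)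
qed

lemma weighted_l2_add:
  assumes "u \<in> weighted_l2 \<sigma>" "v \<in> weighted_l2 \<sigma>"
  shows "(\<lambda>n. u n + v n) \<in> weighted_l2 \<sigma>"
    and "l2_norm \<sigma> (\<lambda>n. u n + v n) \<le> l2_norm \<sigma> u + l2_norm \<sigma> v"
proof -
  have le: "L2_set (weighted_abs \<sigma> (\<lambda>n. u n + v n)) F \<le> l2_norm \<sigma> u + l2_norm \<sigma> v" if F: "finite F" for F
  proof -
    have "L2_set (weighted_abs \<sigma> (\<lambda>n. u n + v n)) F
        \<le> L2_set (\<lambda>n. weighted_abs \<sigma> u n + weighted_abs \<sigma> v n) F"
      by (rule L2_set_mono)
         (auto simp: weighted_abs_def simp flip: distrib_left intro!: mult_left_mono norm_triangle_ineq)
    also have "\<dots> \<le> L2_set (weighted_abs \<sigma> u) F + L2_set (weighted_abs \<sigma> v) F"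
      by (rule L2_set_triangle_ineq)
    also have "\<dots> \<le> l2_norm \<sigma> u + l2_norm \<sigma> v"
      by (intro add_mono L2_set_weighted_le assms F)
    finally show ?thesis .
  qed
  show "(\<lambda>n. u n + v n) \<in> weighted_l2 \<sigma>"
    and "l2_norm \<sigma> (\<lambda>n. u n + v n) \<le> l2_norm \<sigma> u + l2_norm \<sigma> v"
    by (rule weighted_l2I, rule le, assumption)+
qed

lemma weighted_l2_cmult:
  assumes "u \<in> weighted_l2 \<sigma>"
  shows "(\<lambda>n. c * u n) \<in> weighted_l2 \<sigma>"
    and "l2_norm \<sigma> (\<lambda>n. c * u n) \<le> cmod c * l2_norm \<sigma> u"
proof -
  have "L2_set (weighted_abs \<sigma> (\<lambda>n. c * u n)) F \<le> cmod c * l2_norm \<sigma> u" if F: "finite F" for F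
  proof -
    have "L2_set (weighted_abs \<sigma> (\<lambda>n. c * u n)) F = cmod c * L2_set (weighted_abs \<sigma> u) F"
      unfolding L2_set_right_distrib[OF norm_ge_zero]
      by (rule L2_set_cong) (auto simp: weighted_abs_def norm_mult)
    also have "\<dots> \<le> cmod c * l2_norm \<sigma> u"
      by (intro mult_left_mono L2_set_weighted_le assms F) simp
    finally show ?thesis .
  qed
  then show "(\<lambda>n. c * u n) \<in> weighted_l2 \<sigma>"
    and "l2_norm \<sigma> (\<lambda>n. c * u n) \<le> cmod c * l2_norm \<sigma> u"
    using weighted_l2I by blast+
qed

lemma weighted_l2_diff:
  assumes "u \<in> weighted_l2 \<sigma>" "v \<in> weighted_l2 \<sigma>"
  shows "(\<lambda>n. u n - v n) \<in> weighted_l2 \<sigma>"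
    and "l2_norm \<sigma> (\<lambda>n. u n - v n) \<le> l2_norm \<sigma> u + l2_norm \<sigma> v"
  using weighted_l2_add[OF assms(1) weighted_l2_cmult(1)[OF assms(2), of "-1"]]
    weighted_l2_cmult(2)[OF assms(2), of "-1"] by auto

lemma weighted_l2_pointwise:
  assumes "u \<in> weighted_l2 \<sigma>"
  shows "weighted_abs \<sigma> u n \<le> l2_norm \<sigma> u"
  using L2_set_weighted_le[OF assms, of "{n}"] weighted_abs_nonneg[of \<sigma> u n] by (simp add: L2_set_def)

lemma l2_norm_eq_0D:
  assumes "u \<in> weighted_l2 \<sigma>" "l2_norm \<sigma> u = 0"
  shows "u n = 0"
  using weighted_l2_pointwise[OF assms(1), of n] one_plus_square_pos[of n]
  by (simp add: assms(2) weighted_abs_def mult_le_0_iff not_le)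

lemma L2_set_moment_le:
  assumes "\<sigma> > 5/2" "finite F"
  shows "L2_set (\<lambda>n. (bracket n)\<^sup>2 * (1 + (real_of_int n)\<^sup>2) powr (- \<sigma> / 2)) F \<le> moment_const \<sigma>"
proof -
  have "((bracket n)\<^sup>2 * (1 + (real_of_int n)\<^sup>2) powr (- \<sigma> / 2))\<^sup>2
      = bracket n ^ 4 * (1 + (real_of_int n)\<^sup>2) powr (- \<sigma>)" for n
    using one_plus_square_pos[of n]
    by (simp add: power_mult_distrib power2_eq_square power4_eq_xxxx flip: powr_add)
  then show ?thesis
    unfolding L2_set_def moment_const_def
    by (auto intro!: real_sqrt_le_mono finite_sum_le_infsum bracket_moment_summable assms
        simp: bracket_pos less_imp_le)
qed

text \<open>Cauchy-Schwarz on finite sets, with (1 + n^2)^(\<sigma>/2) moved onto u and its inverse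
  onto \<open>(bracket n)\<^sup>2\<close>.\<close>

lemma weighted_l2_moment:
  assumes \<sigma>: "\<sigma> > 5/2" and u: "u \<in> weighted_l2 \<sigma>"
  shows "(\<lambda>n. (bracket n)\<^sup>2 * cmod (u n)) summable_on UNIV"
    and "(\<Sum>\<^sub>\<infinity>n. (bracket n)\<^sup>2 * cmod (u n)) \<le> moment_const \<sigma> * l2_norm \<sigma> u"
proof -
  let ?b = "\<lambda>n. (bracket n)\<^sup>2 * (1 + (real_of_int n)\<^sup>2) powr (- \<sigma> / 2)"
  have eq: "(bracket n)\<^sup>2 * cmod (u n) = \<bar>?b n\<bar> * \<bar>weighted_abs \<sigma> u n\<bar>" for n
    using one_plus_square_pos[of n]
    by (simp add: weighted_abs_def abs_mult powr_minus field_simps)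
  have le: "(\<Sum>n\<in>F. (bracket n)\<^sup>2 * cmod (u n)) \<le> moment_const \<sigma> * l2_norm \<sigma> u" if F: "finite F" for F
  proof -
    have "(\<Sum>n\<in>F. (bracket n)\<^sup>2 * cmod (u n)) \<le> L2_set ?b F * L2_set (weighted_abs \<sigma> u) F"
      unfolding eq by (rule L2_set_mult_ineq)
    also have "\<dots> \<le> moment_const \<sigma> * l2_norm \<sigma> u"
      by (intro mult_mono L2_set_moment_le L2_set_weighted_le \<sigma> u F moment_const_nonneg L2_set_nonneg)
    finally show ?thesis .
  qed
  show "(\<lambda>n. (bracket n)\<^sup>2 * cmod (u n)) summable_on UNIV"
    by (rule nonneg_bdd_above_summable_on)
       (auto intro!: bdd_aboveI[of _ "moment_const \<sigma> * l2_norm \<sigma> u"] le)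
  then show "(\<Sum>\<^sub>\<infinity>n. (bracket n)\<^sup>2 * cmod (u n)) \<le> moment_const \<sigma> * l2_norm \<sigma> u"
    by (rule infsum_le_finite_sums) (use le in auto)
qed

lemma weighted_l2_of_growth:
  assumes \<sigma>: "\<sigma> > 5/2" and u: "\<And>n. cmod (u n) \<le> B * (bracket n)\<^sup>2"
  shows "u \<in> weighted_l2 (- \<sigma>)" and "l2_norm (- \<sigma>) u \<le> B * moment_const \<sigma>"
proof -
  have "0 \<le> B * (bracket 0)\<^sup>2" using u[of 0] norm_ge_zero order.trans by blast
  then have B: "0 \<le> B" by (simp add: bracket_def)
  have le: "L2_set (weighted_abs (- \<sigma>) u) F \<le> B * moment_const \<sigma>" if F: "finite F" for F
  proof -
    have "L2_set (weighted_abs (- \<sigma>) u) F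
        \<le> L2_set (\<lambda>n. B * ((bracket n)\<^sup>2 * (1 + (real_of_int n)\<^sup>2) powr (- \<sigma> / 2))) F"
    proof (rule L2_set_mono)
      fix n
      show "weighted_abs (- \<sigma>) u n \<le> B * ((bracket n)\<^sup>2 * (1 + (real_of_int n)\<^sup>2) powr (- \<sigma> / 2))"
        using mult_left_mono[OF u[of n], of "(1 + (real_of_int n)\<^sup>2) powr (- \<sigma> / 2)"]
        by (simp add: weighted_abs_def mult_ac)
    qed (simp add: weighted_abs_nonneg)
    also have "\<dots> = B * L2_set (\<lambda>n. (bracket n)\<^sup>2 * (1 + (real_of_int n)\<^sup>2) powr (- \<sigma> / 2)) F"
      using B by (simp add: L2_set_right_distrib)
    also have "\<dots> \<le> B * moment_const \<sigma>" by (intro mult_left_mono L2_set_moment_le \<sigma> F B)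
    finally show ?thesis .
  qed
  show "u \<in> weighted_l2 (- \<sigma>)" "l2_norm (- \<sigma>) u \<le> B * moment_const \<sigma>"
    by (rule weighted_l2I, rule le, assumption)+
qed

section \<open>Integral operators with polynomially growing kernels\<close>

definition kernel_op :: "(int \<Rightarrow> int \<Rightarrow> complex) \<Rightarrow> seq_op" where
  "kernel_op k f = (\<lambda>n. \<Sum>\<^sub>\<infinity>m. k n m * f m)"

text \<open>The rank-one majorant separates the variables: pairing with f uses one factor, the norm
  of the image the other. It applies to Green kernels and to their differences alike.\<close>

locale bounded_kernel =
  fixes \<sigma> :: real and k :: "int \<Rightarrow> int \<Rightarrow> complex" and B :: real
  assumes sigma: "\<sigma> > 5/2"
    and kernel_le: "\<And>n m. cmod (k n m) \<le> B * (bracket n)\<^sup>2 * (bracket m)\<^sup>2"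
begin

lemma kernel_term_le: "cmod (k n m * f m) \<le> B * (bracket n)\<^sup>2 * ((bracket m)\<^sup>2 * cmod (f m))"
  using mult_right_mono[OF kernel_le[of n m], of "cmod (f m)"] by (simp add: norm_mult mult_ac)

lemma kernel_majorant_summable:
  assumes "f \<in> weighted_l2 \<sigma>"
  shows "(\<lambda>m. B * (bracket n)\<^sup>2 * ((bracket m)\<^sup>2 * cmod (f m))) summable_on UNIV"
  by (rule summable_on_cmult_right[OF weighted_l2_moment(1)[OF sigma assms]])

lemma kernel_summable:
  assumes "f \<in> weighted_l2 \<sigma>"
  shows "(\<lambda>m. k n m * f m) summable_on UNIV"
  by (rule summable_on_dominated[OF kernel_majorant_summable[OF assms]]) (rule kernel_term_le)

lemma B_nonneg: "0 \<le> B"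
proof -
  have "0 \<le> B * (bracket 0)\<^sup>2 * (bracket 0)\<^sup>2"
    using kernel_le[of 0 0] norm_ge_zero order.trans by blast
  then show ?thesis by (simp add: bracket_def)
qed

lemma kernel_op_growth:
  assumes f: "f \<in> weighted_l2 \<sigma>"
  shows "cmod (kernel_op k f n) \<le> (B * moment_const \<sigma> * l2_norm \<sigma> f) * (bracket n)\<^sup>2"
proof -
  have "cmod (kernel_op k f n) \<le> (\<Sum>\<^sub>\<infinity>m. B * (bracket n)\<^sup>2 * ((bracket m)\<^sup>2 * cmod (f m)))"
    unfolding kernel_op_def
    by (rule norm_infsum_dominated[OF kernel_majorant_summable[OF f]]) (rule kernel_term_le)
  also have "\<dots> = B * (bracket n)\<^sup>2 * (\<Sum>\<^sub>\<infinity>m. (bracket m)\<^sup>2 * cmod (f m))"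
    by (rule infsum_cmult_right) (rule weighted_l2_moment(1)[OF sigma f])
  also have "\<dots> \<le> B * (bracket n)\<^sup>2 * (moment_const \<sigma> * l2_norm \<sigma> f)"
    by (intro mult_left_mono weighted_l2_moment(2)[OF sigma f]) (simp add: B_nonneg)
  finally show ?thesis by (simp add: mult_ac)
qed

lemma kernel_op_weighted: "f \<in> weighted_l2 \<sigma> \<Longrightarrow> kernel_op k f \<in> weighted_l2 (- \<sigma>)"
  by (rule weighted_l2_of_growth(1)[OF sigma kernel_op_growth])

lemma kernel_op_norm_le:
  "f \<in> weighted_l2 \<sigma> \<Longrightarrow> l2_norm (- \<sigma>) (kernel_op k f) \<le> B * (moment_const \<sigma>)\<^sup>2 * l2_norm \<sigma> f"
  using weighted_l2_of_growth(2)[OF sigma kernel_op_growth, of f] by (simp add: power2_eq_square mult_ac)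

lemma kernel_op_bounded: "kernel_op k \<in> bounded_ops \<sigma> (- \<sigma>)"
  unfolding bounded_ops_def mem_Collect_eq
proof (intro conjI ballI allI exI)
  show "kernel_op k u \<in> weighted_l2 (- \<sigma>)" if "u \<in> weighted_l2 \<sigma>" for u
    using that by (rule kernel_op_weighted)
  show "kernel_op k (\<lambda>n. u n + v n) = (\<lambda>n. kernel_op k u n + kernel_op k v n)"
    if "u \<in> weighted_l2 \<sigma>" "v \<in> weighted_l2 \<sigma>" for u v
    using that by (auto simp: kernel_op_def distrib_left infsum_add kernel_summable)
  show "kernel_op k (\<lambda>n. c * u n) = (\<lambda>n. c * kernel_op k u n)" for c u
    by (simp add: kernel_op_def mult.left_commute infsum_cmult_right')
  show "l2_norm (- \<sigma>) (kernel_op k u) \<le> B * (moment_const \<sigma>)\<^sup>2 * l2_norm \<sigma> u"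
    if "u \<in> weighted_l2 \<sigma>" for u
    using that by (rule kernel_op_norm_le)
qed

end

text \<open>The supremum of an unbounded set of reals carries no information, so some bound must be
  known beforehand; it only makes the supremum meaningful and does not enter the conclusion.\<close>

lemma op_norm_upper:
  assumes A: "\<And>u. u \<in> weighted_l2 \<sigma> \<Longrightarrow> A u \<in> weighted_l2 \<tau> \<and> l2_norm \<tau> (A u) \<le> C * l2_norm \<sigma> u"
    and u: "u \<in> weighted_l2 \<sigma>"
  shows "l2_norm \<tau> (A u) \<le> op_norm \<sigma> \<tau> A * l2_norm \<sigma> u"
proof (cases "l2_norm \<sigma> u = 0")
  case True
  then show ?thesis using A[OF u] by simp
next
  case False
  have "bdd_above ((\<lambda>u. l2_norm \<tau> (A u) / l2_norm \<sigma> u) ` weighted_l2 \<sigma>)"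
  proof (rule bdd_aboveI2)
    fix u assume "u \<in> weighted_l2 \<sigma>"
    with A have "l2_norm \<tau> (A u) \<le> C * l2_norm \<sigma> u" by blast
    also have "\<dots> \<le> \<bar>C\<bar> * l2_norm \<sigma> u" by (intro mult_right_mono l2_norm_nonneg) simp
    finally show "l2_norm \<tau> (A u) / l2_norm \<sigma> u \<le> \<bar>C\<bar>"
      using l2_norm_nonneg[of \<sigma> u] by (cases "l2_norm \<sigma> u = 0") (auto simp: divide_le_eq)
  qed
  from cSUP_upper[OF u this] have "l2_norm \<tau> (A u) / l2_norm \<sigma> u \<le> op_norm \<sigma> \<tau> A"
    by (simp add: op_norm_def)
  then show ?thesis using False l2_norm_nonneg[of \<sigma> u] by (simp add: divide_le_eq)
qed

lemma op_norm_least: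
  assumes "\<And>u. u \<in> weighted_l2 \<sigma> \<Longrightarrow> l2_norm \<tau> (A u) \<le> C * l2_norm \<sigma> u" and C: "0 \<le> C"
  shows "op_norm \<sigma> \<tau> A \<le> C"
  unfolding op_norm_def
proof (rule cSUP_least)
  have "(\<lambda>_. 0) \<in> weighted_l2 \<sigma>" by (simp add: weighted_l2_def)
  then show "weighted_l2 \<sigma> \<noteq> {}" by blast
  fix u assume "u \<in> weighted_l2 \<sigma>"
  from assms(1)[OF this] show "l2_norm \<tau> (A u) / l2_norm \<sigma> u \<le> C"
    using l2_norm_nonneg[of \<sigma> u] C by (cases "l2_norm \<sigma> u = 0") (auto simp: divide_le_eq)
qed

text \<open>\<sigma> > 5/2 means 2 \<sigma> - 1 > 4, so the hypothesis on V controls its fourth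
  moment.\<close>

lemma decaying_potential_of_weighted_l1:
  assumes \<sigma>: "\<sigma> > 5/2" and V: "V \<in> weighted_l1 (2 * \<sigma> - 1)"
  shows "decaying_potential V"
proof
  show "(\<lambda>m. bracket m ^ 4 * \<bar>V m\<bar>) summable_on UNIV"
  proof (rule summable_on_dominated)
    show "(\<lambda>m. 4 * ((1 + (real_of_int m)\<^sup>2) powr ((2 * \<sigma> - 1) / 2) * norm (V m))) summable_on UNIV"
      using V by (intro summable_on_cmult_right) (simp add: weighted_l1_def)
    fix m
    have "bracket m ^ 4 = ((bracket m)\<^sup>2)\<^sup>2" by (simp flip: power_mult)
    also have "\<dots> \<le> (2 * (1 + (real_of_int m)\<^sup>2))\<^sup>2" by (intro power_mono bracket_square_le) simp
    also have "\<dots> = 4 * (1 + (real_of_int m)\<^sup>2) powr 2"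
      using one_plus_square_pos[of m] by (simp only: power_mult_distrib powr_numeral) simp
    also have "\<dots> \<le> 4 * (1 + (real_of_int m)\<^sup>2) powr ((2 * \<sigma> - 1) / 2)"
      using \<sigma> by (intro mult_left_mono powr_mono) auto
    finally show "norm (bracket m ^ 4 * \<bar>V m\<bar>) \<le> 4 * ((1 + (real_of_int m)\<^sup>2) powr ((2 * \<sigma> - 1) / 2) * norm (V m))"
      using bracket_pos[of m] by (simp add: abs_mult mult_right_mono flip: mult.assoc)
  qed
qed


section \<open>Jost solutions from both ends and the Green kernel\<close>

lemma bij_betw_uminus_int: "bij_betw uminus (UNIV :: int set) UNIV"
  by (rule bij_betwI[of _ _ _ uminus]) auto

context decaying_potential
begin

lemma reflected: "decaying_potential (\<lambda>n. V (- n))"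
  using summable_V summable_on_reindex_bij_betw[OF bij_betw_uminus_int, of "\<lambda>m. bracket m ^ 4 * \<bar>V m\<bar>"]
  by unfold_locales simp

end

text \<open>A single constant serves both solutions. The recurrences are those of the Schroedinger
  equation after conjugation by l^n and l^(-n), so no inverse of l occurs. At l = 1 the Volterra
  equations are kept as well, since \<open>T0\<close> is recovered from them.\<close>

locale jost_pair = decaying_potential V for V +
  fixes g h :: "complex \<Rightarrow> int \<Rightarrow> complex" and C :: real
  assumes C_pos: "0 < C"
    and g_bound: "\<And>l n. cmod l \<le> 1 \<Longrightarrow> cmod (g l n) \<le> C * bracket n"
    and h_bound: "\<And>l n. cmod l \<le> 1 \<Longrightarrow> cmod (h l n) \<le> C * bracket n"
    and g_rec: "\<And>l n. cmod l \<le> 1 \<Longrightarrow>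
      l\<^sup>2 * g l (n + 1) + g l (n - 1) = (l\<^sup>2 + 1 + l * of_real (V n)) * g l n"
    and h_rec: "\<And>l n. cmod l \<le> 1 \<Longrightarrow>
      l\<^sup>2 * h l (n - 1) + h l (n + 1) = (l\<^sup>2 + 1 + l * of_real (V n)) * h l n"
    and g_diff: "\<And>l n. cmod l \<le> 1 \<Longrightarrow> cmod (g l n - g 1 n) \<le> C * cmod (1 - l) * (bracket n)\<^sup>2"
    and h_diff: "\<And>l n. cmod l \<le> 1 \<Longrightarrow> cmod (h l n - h 1 n) \<le> C * cmod (1 - l) * (bracket n)\<^sup>2"
    and g_volterra: "\<And>n. g 1 n = 1 + (\<Sum>\<^sub>\<infinity>m. of_nat (nat (m - n)) * of_real (V m) * g 1 m)"
    and h_volterra: "\<And>n. h 1 n = 1 + (\<Sum>\<^sub>\<infinity>m. of_nat (nat (n - m)) * of_real (V m) * h 1 m)"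

lemma (in decaying_potential) jost_right_exists:
  obtains g C where "0 < C"
    and "\<And>l n. cmod l \<le> 1 \<Longrightarrow> cmod (g l n) \<le> C * bracket n"
    and "\<And>l n. cmod l \<le> 1 \<Longrightarrow> l\<^sup>2 * g l (n + 1) + g l (n - 1) = (l\<^sup>2 + 1 + l * of_real (V n)) * g l n"
    and "\<And>l n. cmod l \<le> 1 \<Longrightarrow> cmod (g l n - g 1 n) \<le> C * cmod (1 - l) * (bracket n)\<^sup>2"
    and "\<And>n. g 1 n = 1 + (\<Sum>\<^sub>\<infinity>m. of_nat (nat (m - n)) * of_real (V m) * g 1 m)"
proof -
  obtain g where g: "\<And>l. cmod l \<le> 1 \<Longrightarrow> is_jost l (g l)"
    using is_jost_exists by metis
  obtain A where A: "A > 0" "\<And>l g n. is_jost l g \<Longrightarrow> cmod (g n) \<le> A * bracket n"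
    using is_jost_bound by blast
  obtain B where B: "B > 0" "\<And>l g g1 n. cmod l \<le> 1 \<Longrightarrow> is_jost l g \<Longrightarrow> is_jost 1 g1 \<Longrightarrow>
      cmod (g n - g1 n) \<le> B * cmod (1 - l) * (bracket n)\<^sup>2"
    using is_jost_diff_bound by blast
  show thesis
  proof (rule that[of "A + B" g])
    fix l :: complex and n assume l: "cmod l \<le> 1"
    have "A * bracket n \<le> (A + B) * bracket n"
      using B(1) bracket_pos[of n] by (intro mult_right_mono) auto
    with A(2)[OF g[OF l], of n] show "cmod (g l n) \<le> (A + B) * bracket n" by linarith
    show "l\<^sup>2 * g l (n + 1) + g l (n - 1) = (l\<^sup>2 + 1 + l * of_real (V n)) * g l n"
      using is_jost_recurrence[OF l g[OF l], of n] by (simp add: algebra_simps)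
    have "B * cmod (1 - l) * (bracket n)\<^sup>2 \<le> (A + B) * cmod (1 - l) * (bracket n)\<^sup>2"
      using A(1) by (intro mult_right_mono) auto
    with B(2)[OF l g[OF l] g, of n] show "cmod (g l n - g 1 n) \<le> (A + B) * cmod (1 - l) * (bracket n)\<^sup>2"
      by simp
  next
    fix n
    show "g 1 n = 1 + (\<Sum>\<^sub>\<infinity>m. of_nat (nat (m - n)) * of_real (V m) * g 1 m)"
      using is_jostD(2)[OF g, of 1 n] by (simp add: jost_kernel_one)
  qed (use A B in simp)
qed

text \<open>The left Jost solution is the right one of the reflected potential, read
  backwards.\<close>

lemma (in decaying_potential) jost_pair_exists: "\<exists>g h C. jost_pair V g h C"
proof -
  obtain g A where g: "0 < A"
    "\<And>l n. cmod l \<le> 1 \<Longrightarrow> cmod (g l n) \<le> A * bracket n"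
    "\<And>l n. cmod l \<le> 1 \<Longrightarrow> l\<^sup>2 * g l (n + 1) + g l (n - 1) = (l\<^sup>2 + 1 + l * of_real (V n)) * g l n"
    "\<And>l n. cmod l \<le> 1 \<Longrightarrow> cmod (g l n - g 1 n) \<le> A * cmod (1 - l) * (bracket n)\<^sup>2"
    "\<And>n. g 1 n = 1 + (\<Sum>\<^sub>\<infinity>m. of_nat (nat (m - n)) * of_real (V m) * g 1 m)"
    by (rule jost_right_exists, rule that)
  interpret R: decaying_potential "\<lambda>n. V (- n)" by (rule reflected)
  obtain h B where h: "0 < B"
    "\<And>l n. cmod l \<le> 1 \<Longrightarrow> cmod (h l n) \<le> B * bracket n"
    "\<And>l n. cmod l \<le> 1 \<Longrightarrow> l\<^sup>2 * h l (n + 1) + h l (n - 1) = (l\<^sup>2 + 1 + l * of_real (V (- n))) * h l n"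
    "\<And>l n. cmod l \<le> 1 \<Longrightarrow> cmod (h l n - h 1 n) \<le> B * cmod (1 - l) * (bracket n)\<^sup>2"
    "\<And>n. h 1 n = 1 + (\<Sum>\<^sub>\<infinity>m. of_nat (nat (m - n)) * of_real (V (- m)) * h 1 m)"
    by (rule R.jost_right_exists, rule that)
  have le: "A * x \<le> (A + B) * x" "B * x \<le> (A + B) * x" if "0 \<le> x" for x
    using that g(1) h(1) by (auto simp: mult_right_mono)
  have "jost_pair V g (\<lambda>l n. h l (- n)) (A + B)"
  proof unfold_locales
    fix l :: complex and n assume l: "cmod l \<le> 1"
    show "cmod (g l n) \<le> (A + B) * bracket n" "cmod (h l (- n)) \<le> (A + B) * bracket n"
      using order.trans[OF g(2)[OF l] le(1)[OF bracket_nonneg]]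
        order.trans[OF h(2)[OF l, of "- n"] le(2)[OF bracket_nonneg]] by simp_all
    show "cmod (g l n - g 1 n) \<le> (A + B) * cmod (1 - l) * (bracket n)\<^sup>2"
      "cmod (h l (- n) - h 1 (- n)) \<le> (A + B) * cmod (1 - l) * (bracket n)\<^sup>2"
      using order.trans[OF g(4)[OF l, of n, unfolded mult.assoc] le(1)]
        order.trans[OF h(4)[OF l, of "- n", unfolded mult.assoc] le(2)] by (simp_all add: mult.assoc)
    show "l\<^sup>2 * g l (n + 1) + g l (n - 1) = (l\<^sup>2 + 1 + l * of_real (V n)) * g l n"
      by (rule g(3)[OF l])
    show "l\<^sup>2 * h l (- (n - 1)) + h l (- (n + 1)) = (l\<^sup>2 + 1 + l * of_real (V n)) * h l (- n)"
    proof -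
      have "- (n - 1) = - n + 1" "- (n + 1) = - n - 1" by auto
      then show ?thesis using h(3)[OF l, of "- n"] by simp
    qed
  next
    fix n
    show "g 1 n = 1 + (\<Sum>\<^sub>\<infinity>m. of_nat (nat (m - n)) * of_real (V m) * g 1 m)" by (rule g(5))
    have "(\<Sum>\<^sub>\<infinity>m. of_nat (nat (m + n)) * of_real (V (- m)) * h 1 m)
        = (\<Sum>\<^sub>\<infinity>m. of_nat (nat (n - m)) * of_real (V m) * h 1 (- m))"
      using infsum_reindex_bij_betw[OF bij_betw_uminus_int,
          of "\<lambda>m. of_nat (nat (m + n)) * of_real (V (- m)) * h 1 m"] by simp
    then show "h 1 (- n) = 1 + (\<Sum>\<^sub>\<infinity>m. of_nat (nat (n - m)) * of_real (V m) * h 1 (- m))"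
      using h(5)[of "- n"] by simp
  qed (use g(1) h(1) in simp)
  then show ?thesis by blast
qed

lemma norm_mult_diff_le:
  fixes a b c d :: "'a::real_normed_algebra"
  shows "norm (a * b - c * d) \<le> norm (a - c) * norm b + norm c * norm (b - d)"
proof -
  have "a * b - c * d = (a - c) * b + c * (b - d)" by (simp add: algebra_simps)
  then show ?thesis
    using norm_triangle_ineq[of "(a - c) * b" "c * (b - d)"] norm_mult_ineq[of "a - c" b]
      norm_mult_ineq[of c "b - d"] by simp
qed

text \<open>For \<open>\<bar>l\<bar> < 1\<close> the sequence \<open>l ^ n * g n\<close> is the decaying solution, and \<open>l ^ n\<close> times the
  difference of the two sides is its Wronskian with \<open>d\<close>, which is constant and vanishes at infinity.\<close>

lemma decaying_solution_unique:
  fixes l :: complex and g d q :: "int \<Rightarrow> complex"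
  assumes l: "cmod l < 1"
    and g: "\<And>n. l\<^sup>2 * g (n + 1) + g (n - 1) = q n * g n" "\<And>n. cmod (g n) \<le> C * bracket n"
    and d: "\<And>n. l * (d (n + 1) + d (n - 1)) = q n * d n" "\<And>n. cmod (d n) \<le> D"
  shows "d n * l * g (n + 1) = d (n + 1) * g n"
proof -
  define X where "X n = d n * l * g (n + 1) - d (n + 1) * g n" for n
  have step: "X n = l * X (n + 1)" for n
  proof -
    have "l * X (n + 1) - X n
        = d (n + 1) * (l\<^sup>2 * g (n + 2) + g n) - l * (d (n + 2) + d n) * g (n + 1)"
      by (simp add: X_def algebra_simps power2_eq_square)
    also have "\<dots> = 0"
      using g(1)[of "n + 1"] d(1)[of "n + 1"] by (simp add: algebra_simps)
    finally show ?thesis by simp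
  qed
  have iter: "X n = l ^ k * X (n + int k)" for k
  proof (induction k)
    case (Suc k)
    have "X n = l ^ k * (l * X (n + int k + 1))" using Suc step[of "n + int k"] by simp
    then show ?case by (simp add: add_ac mult_ac)
  qed simp
  have D: "0 \<le> D" and C: "0 \<le> C"
  proof -
    show "0 \<le> D" using d(2)[of 0] norm_ge_zero order.trans by blast
    have "0 \<le> C * bracket 0" using g(2)[of 0] norm_ge_zero order.trans by blast
    then show "0 \<le> C" by (simp add: bracket_def)
  qed
  have X_le: "cmod (X n) \<le> 3 * C * D * bracket n" for n
  proof -
    have b: "bracket (n + 1) \<le> 2 * bracket n"
      using bracket_add_le[of n 1] by (simp add: bracket_def)
    have "cmod (d n * l * g (n + 1)) \<le> D * 1 * (C * (2 * bracket n))"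
      unfolding norm_mult
      by (intro mult_mono d(2) order.trans[OF g(2)] mult_left_mono b C mult_nonneg_nonneg D)
         (use l in auto)
    moreover have "cmod (d (n + 1) * g n) \<le> D * (C * bracket n)"
      unfolding norm_mult by (intro mult_mono d(2) g(2) D) auto
    ultimately show ?thesis
      unfolding X_def using norm_triangle_ineq4[of "d n * l * g (n + 1)" "d (n + 1) * g n"]
      by (simp add: mult_ac)
  qed
  have le: "cmod (X n) \<le> 3 * C * D * bracket n * (real (Suc k) * cmod l ^ k)" for k
  proof -
    have "bracket (int k) = real (Suc k)" by (simp add: bracket_def)
    then have b: "bracket (n + int k) \<le> bracket n * real (Suc k)"
      using bracket_add_le[of n "int k"] by simp
    have "cmod (X n) = cmod l ^ k * cmod (X (n + int k))"
      using iter[of k] by (simp add: norm_mult norm_power)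
    also have "\<dots> \<le> cmod l ^ k * (3 * C * D * (bracket n * real (Suc k)))"
      by (intro mult_left_mono order.trans[OF X_le] b mult_nonneg_nonneg C D) auto
    finally show ?thesis by (simp only: mult_ac)
  qed
  \<comment> \<open>The differentiated geometric series converges, so its terms tend to 0: the decay
    of |l|^k beats the linear growth of X.\<close>
  have "(\<lambda>k. real (Suc k) * cmod l ^ k) sums (1 / (1 - cmod l)\<^sup>2)"
    using geometric_deriv_sums[of "cmod l"] l by simp
  then have "(\<lambda>k. real (Suc k) * cmod l ^ k) \<longlonglongrightarrow> 0"
    using summable_LIMSEQ_zero sums_summable by blast
  then have "(\<lambda>k. 3 * C * D * bracket n * (real (Suc k) * cmod l ^ k)) \<longlonglongrightarrow> 3 * C * D * bracket n * 0"
    by (intro tendsto_mult tendsto_const)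
  then have "cmod (X n) \<le> 3 * C * D * bracket n * 0"
    by (rule LIMSEQ_le_const) (use le in auto)
  then show ?thesis by (simp add: X_def)
qed

section \<open>Convolutions and the unweighted space\<close>

lemma infsum_finite_sum:
  fixes p :: "'a \<Rightarrow> 'b \<Rightarrow> 'c::{topological_comm_monoid_add, t2_space}"
  assumes "finite F" "\<And>n. n \<in> F \<Longrightarrow> p n summable_on A"
  shows "(\<Sum>\<^sub>\<infinity>m\<in>A. \<Sum>n\<in>F. p n m) = (\<Sum>n\<in>F. infsum (p n) A)"
    and "(\<lambda>m. \<Sum>n\<in>F. p n m) summable_on A"
proof -
  have "((\<lambda>m. \<Sum>n\<in>F. p n m) has_sum (\<Sum>n\<in>F. infsum (p n) A)) A"
    using assms by (induction F rule: finite_induct) (auto intro!: has_sum_add has_sum_infsum)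
  then show "(\<Sum>\<^sub>\<infinity>m\<in>A. \<Sum>n\<in>F. p n m) = (\<Sum>n\<in>F. infsum (p n) A)"
    "(\<lambda>m. \<Sum>n\<in>F. p n m) summable_on A"
    by (auto simp: infsumI has_sum_imp_summable)
qed

text \<open>Young's inequality in l^1: a finite sum over n is moved inside, where every translate of
  r contributes at most its total sum.\<close>

lemma convolution_summable:
  fixes r c :: "int \<Rightarrow> real"
  assumes r: "r summable_on UNIV" "\<And>k. 0 \<le> r k" and c: "c summable_on UNIV" "\<And>k. 0 \<le> c k"
  shows "(\<lambda>m. r (n - m) * c m) summable_on UNIV"
    and "(\<lambda>n. \<Sum>\<^sub>\<infinity>m. r (n - m) * c m) summable_on UNIV"
proof -
  have sum_le: "(\<Sum>n\<in>F. r (n - m)) \<le> infsum r UNIV" if "finite F" for F m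
  proof -
    have "(\<Sum>n\<in>F. r (n - m)) = sum r ((\<lambda>n. n - m) ` F)"
      by (subst sum.reindex) (auto simp: inj_on_def)
    also have "\<dots> \<le> infsum r UNIV"
      by (rule finite_sum_le_infsum) (use that r in auto)
    finally show ?thesis .
  qed
  have Rs: "(\<lambda>m. infsum r UNIV * c m) summable_on UNIV"
    by (rule summable_on_cmult_right[OF c(1)])
  have s: "(\<lambda>m. r (n - m) * c m) summable_on UNIV" for n
  proof (rule summable_on_dominated[OF Rs])
    fix m
    show "norm (r (n - m) * c m) \<le> infsum r UNIV * c m"
      using sum_le[of "{n}" m] r c by (simp add: mult_right_mono)
  qed
  then show "(\<lambda>m. r (n - m) * c m) summable_on UNIV" .
  show "(\<lambda>n. \<Sum>\<^sub>\<infinity>m. r (n - m) * c m) summable_on UNIV"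
  proof (rule nonneg_bdd_above_summable_on)
    show "bdd_above (sum (\<lambda>n. \<Sum>\<^sub>\<infinity>m. r (n - m) * c m) ` {F. F \<subseteq> UNIV \<and> finite F})"
    proof (rule bdd_aboveI2)
      fix F :: "int set" assume "F \<in> {F. F \<subseteq> UNIV \<and> finite F}"
      then have F: "finite F" by simp
      have "(\<Sum>n\<in>F. \<Sum>\<^sub>\<infinity>m. r (n - m) * c m) = (\<Sum>\<^sub>\<infinity>m. \<Sum>n\<in>F. r (n - m) * c m)"
        by (rule infsum_finite_sum(1)[symmetric]) (use F s in auto)
      also have "\<dots> \<le> (\<Sum>\<^sub>\<infinity>m. infsum r UNIV * c m)"
        by (rule infsum_mono[OF infsum_finite_sum(2)[OF F s] Rs])
           (use sum_le[OF F] c in \<open>auto simp: mult_right_mono simp flip: sum_distrib_right\<close>)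
      finally show "(\<Sum>n\<in>F. \<Sum>\<^sub>\<infinity>m. r (n - m) * c m) \<le> (\<Sum>\<^sub>\<infinity>m. infsum r UNIV * c m)" .
    qed
  qed (use r c in \<open>auto intro!: infsum_nonneg\<close>)
qed

lemma bracket_geometric_summable:
  assumes "0 \<le> r" "r < 1"
  shows "(\<lambda>k. bracket k * r ^ nat \<bar>k\<bar>) summable_on UNIV"
proof -
  have "summable (\<lambda>k. real (Suc k) * r ^ k)"
    using geometric_deriv_sums[of r] assms by (auto intro: sums_summable)
  then show ?thesis
    using assms by (intro summable_on_int_of_nat) (simp_all add: bracket_def)
qed

lemma weighted_l2_0_iff: "u \<in> weighted_l2 0 \<longleftrightarrow> (\<lambda>n. (cmod (u n))\<^sup>2) summable_on UNIV"
proof -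
  have "(1 + (real_of_int n)\<^sup>2) powr 0 = 1" for n using one_plus_square_pos[of n] by simp
  then show ?thesis by (simp add: weighted_l2_def)
qed

lemma weighted_l2_0_bounded:
  assumes "u \<in> weighted_l2 0"
  shows "cmod (u n) \<le> l2_norm 0 u"
  using weighted_l2_pointwise[OF assms, of n] one_plus_square_pos[of n] by (simp add: weighted_abs_def)

lemma weighted_l2_0_of_l1:
  assumes "(\<lambda>n. cmod (u n)) summable_on UNIV"
  shows "u \<in> weighted_l2 0"
  unfolding weighted_l2_0_iff
proof (rule summable_on_dominated)
  let ?S = "\<Sum>\<^sub>\<infinity>n. cmod (u n)"
  show "(\<lambda>n. ?S * cmod (u n)) summable_on UNIV" by (rule summable_on_cmult_right[OF assms])
  fix n
  have "cmod (u n) \<le> ?S" using finite_sum_le_infsum[OF assms, of "{n}"] by simp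
  then show "norm ((cmod (u n))\<^sup>2) \<le> ?S * cmod (u n)"
    by (simp add: power2_eq_square mult_right_mono)
qed

section \<open>Wronskian and Green kernel\<close>

context jost_pair
begin

text \<open>For l \<noteq> 0 this is l times the Wronskian of l^n g and l^(-n) h, taken at n = 0.
  The factor l clears the denominator and reappears as the extra power of l in
  \<open>green\<close>.\<close>

definition wronskian :: "complex \<Rightarrow> complex" where
  "wronskian l = g l 0 * h l 1 - l\<^sup>2 * g l 1 * h l 0"

lemma wronskian_const:
  assumes l: "cmod l \<le> 1"
  shows "g l n * h l (n + 1) - l\<^sup>2 * g l (n + 1) * h l n = wronskian l"
proof -
  define w where "w n = g l n * h l (n + 1) - l\<^sup>2 * g l (n + 1) * h l n" for n
  have step: "w (n + 1) = w n" for n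
  proof -
    have "w (n + 1) - w n = g l (n + 1) * (l\<^sup>2 * h l n + h l (n + 2))
        - (l\<^sup>2 * g l (n + 2) + g l n) * h l (n + 1)"
      by (simp add: w_def algebra_simps)
    also have "\<dots> = 0"
      using g_rec[OF l, of "n + 1"] h_rec[OF l, of "n + 1"] by (simp add: algebra_simps)
    finally show ?thesis by simp
  qed
  have "w n = w 0"
  proof (induction n rule: int_induct[of _ 0])
    case (step2 i)
    then show ?case using step[of "i - 1"] by simp
  qed (simp_all add: step)
  then show ?thesis by (simp add: w_def wronskian_def)
qed

text \<open>With \<open>bracket 0 = 1\<close> and \<open>bracket 1 = 2\<close>, the product of
  \<open>g l 0\<close> and \<open>h l 1\<close> contributes 2 + 4, the other product 8 + 2, in units
  of C^2 |1 - l|.\<close>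

lemma wronskian_diff:
  assumes l: "cmod l \<le> 1"
  shows "cmod (wronskian l - wronskian 1) \<le> 16 * C\<^sup>2 * cmod (1 - l)"
proof -
  let ?e = "cmod (1 - l)"
  have b: "bracket 0 = 1" "bracket 1 = 2" by (simp_all add: bracket_def)
  have one: "cmod (1::complex) \<le> 1" by simp
  have bd: "cmod (g l 0) \<le> C" "cmod (h l 0) \<le> C" "cmod (g l 1) \<le> 2 * C" "cmod (h l 1) \<le> 2 * C"
    "cmod (g 1 0) \<le> C" "cmod (g 1 1) \<le> 2 * C"
    using g_bound[OF l, of 0] h_bound[OF l, of 0] g_bound[OF l, of 1] h_bound[OF l, of 1]
      g_bound[OF one, of 0] g_bound[OF one, of 1] by (simp_all add: b mult.commute)
  have df: "cmod (g l 0 - g 1 0) \<le> C * ?e" "cmod (h l 0 - h 1 0) \<le> C * ?e"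
    "cmod (g l 1 - g 1 1) \<le> 4 * C * ?e" "cmod (h l 1 - h 1 1) \<le> 4 * C * ?e"
    using g_diff[OF l, of 0] h_diff[OF l, of 0] g_diff[OF l, of 1] h_diff[OF l, of 1]
    by (simp_all add: b mult_ac)
  have "cmod (g l 0 * h l 1 - g 1 0 * h 1 1) \<le> C * ?e * (2 * C) + C * (4 * C * ?e)"
    by (rule order.trans[OF norm_mult_diff_le])
       (intro add_mono mult_mono bd df; use C_pos in auto)
  moreover have "cmod (l\<^sup>2 * g l 1 * h l 0 - g 1 1 * h 1 0) \<le> (8 * C * ?e) * C + (2 * C) * (C * ?e)"
  proof (rule order.trans[OF norm_mult_diff_le])
    have "cmod (l\<^sup>2 * g l 1 - 1 * g 1 1) \<le> cmod (l\<^sup>2 - 1) * cmod (g l 1) + cmod (1::complex) * cmod (g l 1 - g 1 1)"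
      by (rule norm_mult_diff_le)
    also have "\<dots> \<le> (2 * ?e) * (2 * C) + 1 * (4 * C * ?e)"
      by (intro add_mono mult_mono bd df; use C_pos norm_power_diff_one_le[OF l, of 2] in auto)
    finally have 1: "cmod (l\<^sup>2 * g l 1 - g 1 1) \<le> 8 * C * ?e" by simp
    show "cmod (l\<^sup>2 * g l 1 - g 1 1) * cmod (h l 0) + cmod (g 1 1) * cmod (h l 0 - h 1 0)
        \<le> (8 * C * ?e) * C + (2 * C) * (C * ?e)"
      by (intro add_mono mult_mono bd df 1; use C_pos in auto)
  qed
  moreover have eq: "wronskian l - wronskian 1
      = (g l 0 * h l 1 - g 1 0 * h 1 1) - (l\<^sup>2 * g l 1 * h l 0 - g 1 1 * h 1 0)"
    by (simp add: wronskian_def)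
  ultimately show ?thesis
    unfolding eq using norm_triangle_ineq4[of "g l 0 * h l 1 - g 1 0 * h 1 1" "l\<^sup>2 * g l 1 * h l 0 - g 1 1 * h 1 0"]
    by (simp add: power2_eq_square)
qed

text \<open>The resolvent kernel at the spectral parameter \<open>2 - l - 1 / l\<close>; \<open>l ^ n * g l n\<close> and
  \<open>l ^ (- n) * h l n\<close> are the Jost solutions, and the negative powers have been cancelled.\<close>

definition green :: "complex \<Rightarrow> int \<Rightarrow> int \<Rightarrow> complex" where
  "green l n m = l ^ (nat \<bar>n - m\<bar> + 1) * (g l (max n m) * h l (min n m)) / wronskian l"

lemma bracket_max_min: "bracket (max n m) * bracket (min n m) = bracket n * bracket m"
  by (auto simp: max_def min_def mult.commute)

text \<open>The brackets of the maximum and the minimum multiply to those of n and m. Should the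
  Wronskian vanish, division by zero makes both sides 0.\<close>

lemma green_bound:
  assumes l: "cmod l \<le> 1"
  shows "cmod (green l n m)
    \<le> C\<^sup>2 / cmod (wronskian l) * (bracket n * bracket m * cmod l ^ nat \<bar>n - m\<bar>)"
proof -
  have "cmod l ^ (nat \<bar>n - m\<bar> + 1) * (cmod (g l (max n m)) * cmod (h l (min n m)))
      \<le> cmod l ^ nat \<bar>n - m\<bar> * ((C * bracket (max n m)) * (C * bracket (min n m)))"
    by (intro mult_mono g_bound h_bound l power_decreasing)
       (use l C_pos in auto)
  also have "\<dots> = C\<^sup>2 * (bracket n * bracket m * cmod l ^ nat \<bar>n - m\<bar>)"
    using bracket_max_min[of n m] by (simp add: power2_eq_square mult_ac)
  finally show ?thesis
    by (simp add: green_def norm_mult norm_divide norm_power divide_right_mono)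
qed

text \<open>The power of l, the product of Jost solutions and the inverse Wronskian are all
  Lipschitz at l = 1. With b the product of the two brackets, the power costs b on top of the factor
  b from the solutions, their difference costs b^2, so every term is within b^2.\<close>

lemma green_diff:
  assumes W: "wronskian 1 \<noteq> 0"
  shows "\<exists>\<delta>>0. \<exists>D>0. \<forall>l n m. cmod l \<le> 1 \<longrightarrow> cmod (1 - l) < \<delta> \<longrightarrow> wronskian l \<noteq> 0 \<and>
    cmod (green l n m - green 1 n m) \<le> D * cmod (1 - l) * (bracket n)\<^sup>2 * (bracket m)\<^sup>2"
proof -
  define w where "w = cmod (wronskian 1)"
  have w: "0 < w" using W by (simp add: w_def)
  \<comment> \<open>\<delta> is chosen so that 16 C^2 |1 - l| \<le> w / 2, which keeps the Wronskian
    above w / 2. In D, the first term is 3 C^2 from the numerator times 2 / w, the second comes from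
    the difference of the inverse Wronskians.\<close>
  define D where "D = C\<^sup>2 * (6 / w + 32 * C\<^sup>2 / w\<^sup>2)"
  define \<delta> where "\<delta> = w / (32 * C\<^sup>2)"
  have D: "0 < D" unfolding D_def using C_pos w by (intro mult_pos_pos add_pos_nonneg) auto
  have \<delta>: "0 < \<delta>" unfolding \<delta>_def using C_pos w by simp
  have "wronskian l \<noteq> 0 \<and>
      cmod (green l n m - green 1 n m) \<le> D * cmod (1 - l) * (bracket n)\<^sup>2 * (bracket m)\<^sup>2"
    if l: "cmod l \<le> 1" and le: "cmod (1 - l) < \<delta>" for l n m
  proof
    let ?e = "cmod (1 - l)"
    define x y where "x = max n m" and "y = min n m"
    define b where "b = bracket n * bracket m"
    define p where "p = l ^ (nat \<bar>n - m\<bar> + 1)"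
    have bxy: "bracket x * bracket y = b" by (simp add: x_def y_def b_def bracket_max_min)
    have b1: "1 \<le> b" unfolding b_def using mult_mono[OF bracket_ge_1[of n] bracket_ge_1[of m]] by simp
    have bb: "b \<le> b\<^sup>2" using b1 by (simp add: power2_eq_square)
    have "16 * C\<^sup>2 * ?e \<le> w / 2" using le C_pos by (simp add: \<delta>_def field_simps)
    then have "w / 2 \<le> cmod (wronskian l)"
      using wronskian_diff[OF l] norm_triangle_ineq3[of "wronskian l" "wronskian 1"]
      unfolding w_def by linarith
    then show Wl: "wronskian l \<noteq> 0" using w by auto
    have iWl: "inverse (cmod (wronskian l)) \<le> 2 / w"
      using le_imp_inverse_le[OF \<open>w / 2 \<le> cmod (wronskian l)\<close>] w by simp
    have one: "cmod (1::complex) \<le> 1" by simp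
    have p: "cmod (p - 1) \<le> b * ?e"
    proof -
      \<comment> \<open>The exponent of l, including its extra 1, is exactly the bracket of n -
        m.\<close>
      have "real (nat \<bar>n - m\<bar> + 1) = bracket (n + - m)" by (simp add: bracket_def)
      also have "\<dots> \<le> b" using bracket_add_le[of n "- m"] by (simp add: b_def)
      finally show ?thesis
        unfolding p_def
        by (intro order.trans[OF norm_power_diff_one_le[OF l]] mult_right_mono) auto
    qed
    have gh: "cmod (g l x * h l y) \<le> C\<^sup>2 * b" "cmod (g 1 x * h 1 y) \<le> C\<^sup>2 * b"
    proof -
      have "cmod (g k x * h k y) \<le> C\<^sup>2 * b" if k: "cmod k \<le> 1" for k
      proof -
        have "cmod (g k x * h k y) \<le> (C * bracket x) * (C * bracket y)"
          unfolding norm_mult by (intro mult_mono g_bound h_bound k)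
            (use C_pos in auto)
        also have "\<dots> = C\<^sup>2 * b" using bxy by (simp add: power2_eq_square mult_ac)
        finally show ?thesis .
      qed
      then show "cmod (g l x * h l y) \<le> C\<^sup>2 * b" "cmod (g 1 x * h 1 y) \<le> C\<^sup>2 * b"
        using l one by blast+
    qed
    have ghd: "cmod (g l x * h l y - g 1 x * h 1 y) \<le> 2 * C\<^sup>2 * ?e * b\<^sup>2"
    proof (rule order.trans[OF norm_mult_diff_le])
      have "cmod (g l x - g 1 x) * cmod (h l y) \<le> (C * ?e * (bracket x)\<^sup>2) * (C * (bracket y)\<^sup>2)"
      proof (intro mult_mono g_diff[OF l] order.trans[OF h_bound[OF l]] mult_left_mono)
        show "bracket y \<le> (bracket y)\<^sup>2" using bracket_ge_1[of y] by (simp add: power2_eq_square)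
      qed (use C_pos in auto)
      moreover have "cmod (g 1 x) * cmod (h l y - h 1 y) \<le> (C * (bracket x)\<^sup>2) * (C * ?e * (bracket y)\<^sup>2)"
      proof (intro mult_mono h_diff[OF l] order.trans[OF g_bound[OF one]] mult_left_mono)
        show "bracket x \<le> (bracket x)\<^sup>2" using bracket_ge_1[of x] by (simp add: power2_eq_square)
      qed (use C_pos in auto)
      moreover have "2 * C\<^sup>2 * ?e * b\<^sup>2 = (C * ?e * (bracket x)\<^sup>2) * (C * (bracket y)\<^sup>2) + (C * (bracket x)\<^sup>2) * (C * ?e * (bracket y)\<^sup>2)"
        unfolding bxy[symmetric] by (simp add: power2_eq_square mult_ac)
      ultimately show "cmod (g l x - g 1 x) * cmod (h l y) + cmod (g 1 x) * cmod (h l y - h 1 y) \<le> 2 * C\<^sup>2 * ?e * b\<^sup>2"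
        by linarith
    qed
    have "cmod (p * (g l x * h l y) - 1 * (g 1 x * h 1 y))
        \<le> cmod (p - 1) * cmod (g l x * h l y) + cmod (1::complex) * cmod (g l x * h l y - g 1 x * h 1 y)"
      by (rule norm_mult_diff_le)
    also have "\<dots> \<le> (b * ?e) * (C\<^sup>2 * b) + 1 * (2 * C\<^sup>2 * ?e * b\<^sup>2)"
      by (intro add_mono mult_mono p gh ghd; use b1 in auto)
    finally have N: "cmod (p * (g l x * h l y) - g 1 x * h 1 y) \<le> 3 * C\<^sup>2 * ?e * b\<^sup>2"
      by (simp add: power2_eq_square mult_ac)
    have iW: "cmod (inverse (wronskian l) - inverse (wronskian 1)) \<le> 32 * C\<^sup>2 * ?e / w\<^sup>2"
    proof -
      have "cmod (inverse (wronskian l) - inverse (wronskian 1))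
          = inverse (cmod (wronskian l)) * cmod (wronskian l - wronskian 1) * inverse w"
        using inverse_diff_inverse[OF Wl W] by (simp add: norm_mult norm_inverse w_def)
      also have "\<dots> \<le> (2 / w) * (16 * C\<^sup>2 * ?e) * inverse w"
        by (intro mult_mono iWl wronskian_diff[OF l]) (use w in auto)
      also have "\<dots> = 32 * C\<^sup>2 * ?e / w\<^sup>2" using w by (simp add: field_simps power2_eq_square)
      finally show ?thesis .
    qed
    have "green l n m - green 1 n m
        = (p * (g l x * h l y)) * inverse (wronskian l) - (g 1 x * h 1 y) * inverse (wronskian 1)"
      by (simp add: green_def p_def x_def y_def divide_inverse)
    also have "cmod \<dots> \<le> cmod (p * (g l x * h l y) - g 1 x * h 1 y) * cmod (inverse (wronskian l))
        + cmod (g 1 x * h 1 y) * cmod (inverse (wronskian l) - inverse (wronskian 1))"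
      by (rule norm_mult_diff_le)
    also have "\<dots> \<le> (3 * C\<^sup>2 * ?e * b\<^sup>2) * (2 / w) + (C\<^sup>2 * b\<^sup>2) * (32 * C\<^sup>2 * ?e / w\<^sup>2)"
    proof (intro add_mono mult_mono N iW)
      show "cmod (g 1 x * h 1 y) \<le> C\<^sup>2 * b\<^sup>2"
        by (rule order.trans[OF gh(2)]) (intro mult_left_mono bb, simp)
    qed (use iWl in \<open>auto simp: norm_inverse\<close>)
    also have "\<dots> = D * ?e * (bracket n)\<^sup>2 * (bracket m)\<^sup>2"
      by (simp add: D_def b_def power_mult_distrib algebra_simps)
    finally show "cmod (green l n m - green 1 n m) \<le> D * ?e * (bracket n)\<^sup>2 * (bracket m)\<^sup>2" .
  qed
  with D \<delta> show ?thesis by blast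
qed

text \<open>Off the diagonal, n and both its neighbours lie on the same side of m, so one Jost
  factor is frozen and the other obeys its recurrence. On the diagonal the neighbour m - 1 switches
  factors, and the resulting jump is the Wronskian.\<close>

lemma green_equation:
  assumes l: "cmod l \<le> 1" and W: "wronskian l \<noteq> 0"
  shows "(l\<^sup>2 + 1 + l * of_real (V n)) * green l n m - l * (green l (n + 1) m + green l (n - 1) m)
    = (if n = m then l else 0)"
proof -
  define q where "q = l\<^sup>2 + 1 + l * of_real (V n)"
  let ?W = "wronskian l"
  have frac: "q * (x / ?W) - l * (y / ?W + z / ?W) = (q * x - l * (y + z)) / ?W" for x y z
    by (simp add: diff_divide_distrib flip: add_divide_distrib)
  have factor: "q * (l ^ (k + 1 + 1) * (a * c)) - l * (l ^ (k + 2 + 1) * (b * c) + l ^ (k + 1) * (b' * c))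
      = l ^ (k + 2) * c * (q * a - (l\<^sup>2 * b + b'))" for k a b b' c
    by (simp add: algebra_simps power2_eq_square)
  have "q * green l n m - l * (green l (n + 1) m + green l (n - 1) m) = (if n = m then l else 0)"
  proof (cases n m rule: linorder_cases)
    case equal
    have e: "nat \<bar>m - m\<bar> = 0" "nat \<bar>m + 1 - m\<bar> = 1" "nat \<bar>m - 1 - m\<bar> = 1"
      "max m m = m" "max (m + 1) m = m + 1" "max (m - 1) m = m"
      "min m m = m" "min (m + 1) m = m" "min (m - 1) m = m - 1"
      by auto
    have "q * green l m m - l * (green l (m + 1) m + green l (m - 1) m)
        = l * ((q * g l m) * h l m - l\<^sup>2 * g l (m + 1) * h l m - l\<^sup>2 * g l m * h l (m - 1)) / ?W"
      unfolding green_def e frac by (simp add: algebra_simps power2_eq_square)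
    also have "q * g l m = l\<^sup>2 * g l (m + 1) + g l (m - 1)"
      using g_rec[OF l, of m] equal by (simp add: q_def)
    also have "(l\<^sup>2 * g l (m + 1) + g l (m - 1)) * h l m - l\<^sup>2 * g l (m + 1) * h l m - l\<^sup>2 * g l m * h l (m - 1)
        = ?W"
      using wronskian_const[OF l, of "m - 1"] by (simp add: algebra_simps)
    finally show ?thesis using W equal by simp
  next
    case greater
    define k where "k = nat (n - m - 1)"
    have e: "nat \<bar>n - m\<bar> = k + 1" "nat \<bar>n + 1 - m\<bar> = k + 2" "nat \<bar>n - 1 - m\<bar> = k"
      "max n m = n" "max (n + 1) m = n + 1" "max (n - 1) m = n - 1"
      "min n m = m" "min (n + 1) m = m" "min (n - 1) m = m"
      using greater by (auto simp: k_def)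
    show ?thesis
      using greater g_rec[OF l, of n] unfolding green_def e frac factor by (simp add: q_def)
  next
    case less
    define k where "k = nat (m - n - 1)"
    have e: "nat \<bar>n - m\<bar> = k + 1" "nat \<bar>n - 1 - m\<bar> = k + 2" "nat \<bar>n + 1 - m\<bar> = k"
      "max n m = m" "max (n + 1) m = m" "max (n - 1) m = m"
      "min n m = n" "min (n + 1) m = n + 1" "min (n - 1) m = n - 1"
      using less by (auto simp: k_def)
    \<comment> \<open>Left of m the roles of the Jost factors and of the two neighbours are
      exchanged; the commutations restore the shape of \<open>factor\<close>.\<close>
    show ?thesis
      using less h_rec[OF l, of n]
      unfolding green_def e frac mult.commute[of "g l m"] add.commute[of "l ^ (k + 1) * _"] factor
      by (simp add: q_def)
  qed
  then show ?thesis by (simp add: q_def)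
qed

lemma green_bounded_kernel:
  assumes l: "cmod l \<le> 1" and \<sigma>: "\<sigma> > 5/2"
  shows "bounded_kernel \<sigma> (green l) (C\<^sup>2 / cmod (wronskian l))"
proof
  fix n m
  have "bracket n * bracket m * cmod l ^ nat \<bar>n - m\<bar> \<le> (bracket n)\<^sup>2 * (bracket m)\<^sup>2 * 1"
    using l bracket_ge_1[of n] bracket_ge_1[of m] bracket_pos[of n] bracket_pos[of m]
    by (intro mult_mono power_le_one) (auto simp: power2_eq_square)
  then have "C\<^sup>2 / cmod (wronskian l) * (bracket n * bracket m * cmod l ^ nat \<bar>n - m\<bar>)
      \<le> C\<^sup>2 / cmod (wronskian l) * ((bracket n)\<^sup>2 * (bracket m)\<^sup>2)"
    by (intro mult_left_mono) auto
  with green_bound[OF l, of n m] show "cmod (green l n m) \<le> C\<^sup>2 / cmod (wronskian l) * (bracket n)\<^sup>2 * (bracket m)\<^sup>2"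
    by (simp add: mult.assoc)
qed (rule \<sigma>)

text \<open>\<open>resolvent\<close> is a \<open>the_inv_into\<close>, so three facts are required:
  injectivity on l^2, which follows from W \<noteq> 0; membership of the Green potential of f in
  l^2, which uses |l| < 1; and the equation for it. Everything is multiplied by l to remain
  polynomial.\<close>

lemma resolvent_eq_green:
  assumes l: "cmod l < 1" "l \<noteq> 0" and z: "l\<^sup>2 + 1 = l * (2 - z)"
    and W: "wronskian l \<noteq> 0" and \<sigma>: "\<sigma> > 5/2" and f: "f \<in> weighted_l2 \<sigma>"
  shows "resolvent V z f = kernel_op (green l) f"
proof -
  have l1: "cmod l \<le> 1" using l by simp
  interpret K: bounded_kernel \<sigma> "green l" "C\<^sup>2 / cmod (wronskian l)"
    by (rule green_bounded_kernel[OF l1 \<sigma>])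
  let ?H = "\<lambda>u n. schroedinger V u n - z * u n"
  have H: "l * ?H u n = (l\<^sup>2 + 1 + l * of_real (V n)) * u n - l * (u (n + 1) + u (n - 1))" for u n
    unfolding z by (simp add: schroedinger_def neg_laplacian_def algebra_simps)
  have inj: "inj_on ?H (weighted_l2 0)"
  proof (rule inj_onI)
    fix u v assume u: "u \<in> weighted_l2 0" and v: "v \<in> weighted_l2 0" and eq: "?H u = ?H v"
    define d where "d n = u n - v n" for n
    have d0: "d \<in> weighted_l2 0" using weighted_l2_diff(1)[OF u v] by (simp add: d_def[abs_def])
    have d_rec: "l * (d (n + 1) + d (n - 1)) = (l\<^sup>2 + 1 + l * of_real (V n)) * d n" for n
    proof -
      have "(l\<^sup>2 + 1 + l * of_real (V n)) * d n - l * (d (n + 1) + d (n - 1)) = l * ?H u n - l * ?H v n"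
        unfolding H d_def by (simp add: algebra_simps)
      then show ?thesis using fun_cong[OF eq, of n] by simp
    qed
    have R: "d n * l * g l (n + 1) = d (n + 1) * g l n" for n
      by (rule decaying_solution_unique[OF l(1) g_rec[OF l1] g_bound[OF l1] d_rec weighted_l2_0_bounded[OF d0]])
    \<comment> \<open>The uniqueness lemma applied to the reflected sequences, evaluated at -(n +
      1).\<close>
    have L: "d (n + 1) * l * h l n = d n * h l (n + 1)" for n
    proof -
      have "d (- (- (n + 1))) * l * h l (- (- (n + 1) + 1)) = d (- (- (n + 1) + 1)) * h l (- (- (n + 1)))"
      proof (rule decaying_solution_unique[where d = "\<lambda>n. d (- n)" and g = "\<lambda>n. h l (- n)"
            and q = "\<lambda>n. l\<^sup>2 + 1 + l * of_real (V (- n))", OF l(1)])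
        fix k
        show "l\<^sup>2 * h l (- (k + 1)) + h l (- (k - 1)) = (l\<^sup>2 + 1 + l * of_real (V (- k))) * h l (- k)"
        proof -
          have "- (k - 1) = - k + 1" "- (k + 1) = - k - 1" by auto
          then show ?thesis using h_rec[OF l1, of "- k"] by simp
        qed
        show "cmod (h l (- k)) \<le> C * bracket k" using h_bound[OF l1, of "- k"] by simp
        show "l * (d (- (k + 1)) + d (- (k - 1))) = (l\<^sup>2 + 1 + l * of_real (V (- k))) * d (- k)"
        proof -
          have e: "- (k - 1) = - k + 1" "- (k + 1) = - k - 1" by auto
          show ?thesis unfolding e add.commute[of "d (- k - 1)" "d (- k + 1)"] by (rule d_rec)
        qed
        show "cmod (d (- k)) \<le> l2_norm 0 d" by (rule weighted_l2_0_bounded[OF d0])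
      qed
      then show ?thesis by (simp add: add.commute)
    qed
    have "d n = 0" for n
    proof -
      \<comment> \<open>A bounded solution has zero Wronskian with both decaying solutions; since
        these are independent, it vanishes.\<close>
      have "d n * wronskian l = g l n * (d n * h l (n + 1)) - l * h l n * (d n * l * g l (n + 1))"
        unfolding wronskian_const[OF l1, of n, symmetric] by (simp add: algebra_simps power2_eq_square)
      also have "\<dots> = 0" unfolding R L[symmetric] by (simp add: algebra_simps)
      finally show ?thesis using W by simp
    qed
    then show "u = v" by (auto simp: d_def)
  qed
  let ?B = "C\<^sup>2 / cmod (wronskian l)"
  let ?r = "\<lambda>k. bracket k * cmod l ^ nat \<bar>k\<bar>" and ?c = "\<lambda>m. (bracket m)\<^sup>2 * cmod (f m)"
  have r: "?r summable_on UNIV" "0 \<le> ?r k" for k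
    using bracket_geometric_summable[of "cmod l"] l bracket_pos[of k] by auto
  have c: "?c summable_on UNIV" "0 \<le> ?c m" for m
    using weighted_l2_moment(1)[OF \<sigma> f] by auto
  note conv = convolution_summable[OF r c]
  \<comment> \<open>The growth in n is split as
    \<open>bracket n \<le> bracket (n - m) * bracket m\<close>; the first factor is absorbed by
    |l|^|n - m|, the second by the moment of f. A convolution of l^1 sequences remains, and l^1 is
    contained in l^2.\<close>
  have mem: "kernel_op (green l) f \<in> weighted_l2 0"
  proof (rule weighted_l2_0_of_l1, rule summable_on_dominated)
    show "(\<lambda>n. ?B * (\<Sum>\<^sub>\<infinity>m. ?r (n - m) * ?c m)) summable_on UNIV"
      by (rule summable_on_cmult_right[OF conv(2)])
    fix n
    have "cmod (kernel_op (green l) f n) \<le> (\<Sum>\<^sub>\<infinity>m. ?B * (?r (n - m) * ?c m))"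
      unfolding kernel_op_def
    proof (rule norm_infsum_dominated[OF summable_on_cmult_right[OF conv(1)]])
      fix m
      have b: "bracket n \<le> bracket (n - m) * bracket m"
        using bracket_add_le[of "n - m" m] by simp
      have "bracket n * bracket m * cmod l ^ nat \<bar>n - m\<bar> \<le> (bracket (n - m) * bracket m) * bracket m * cmod l ^ nat \<bar>n - m\<bar>"
        by (intro mult_right_mono b) (use bracket_pos[of m] in auto)
      also have "\<dots> = ?r (n - m) * (bracket m)\<^sup>2" by (simp add: power2_eq_square mult_ac)
      finally have "cmod (green l n m) \<le> ?B * (?r (n - m) * (bracket m)\<^sup>2)"
        by (intro order.trans[OF green_bound[OF l1]] mult_left_mono) auto
      from mult_right_mono[OF this norm_ge_zero[of "f m"]]
      show "cmod (green l n m * f m) \<le> ?B * (?r (n - m) * ?c m)"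
        by (simp add: norm_mult mult_ac)
    qed
    also have "\<dots> = ?B * (\<Sum>\<^sub>\<infinity>m. ?r (n - m) * ?c m)"
      by (rule infsum_cmult_right) (rule conv(1))
    finally show "norm (cmod (kernel_op (green l) f n)) \<le> ?B * (\<Sum>\<^sub>\<infinity>m. ?r (n - m) * ?c m)" by simp
  qed
  have "?H (kernel_op (green l) f) n = f n" for n
  proof -
    let ?q = "l\<^sup>2 + 1 + l * of_real (V n)"
    have hs: "((\<lambda>m. green l k m * f m) has_sum kernel_op (green l) f k) UNIV" for k
      unfolding kernel_op_def by (rule has_sum_infsum[OF K.kernel_summable[OF f]])
    have "((\<lambda>m. ?q * (green l n m * f m) + - l * (green l (n + 1) m * f m + green l (n - 1) m * f m)) has_sum
        (?q * kernel_op (green l) f n + - l * (kernel_op (green l) f (n + 1) + kernel_op (green l) f (n - 1)))) UNIV"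
      by (intro has_sum_add has_sum_cmult_right hs)
    moreover have "?q * (green l n m * f m) + - l * (green l (n + 1) m * f m + green l (n - 1) m * f m)
        = (if m = n then l * f n else 0)" for m
    proof -
      have "?q * (green l n m * f m) + - l * (green l (n + 1) m * f m + green l (n - 1) m * f m)
          = (?q * green l n m - l * (green l (n + 1) m + green l (n - 1) m)) * f m"
        by (simp add: algebra_simps)
      then show ?thesis unfolding green_equation[OF l1 W] by auto
    qed
    ultimately have "((\<lambda>m. if m = n then l * f n else 0) has_sum l * ?H (kernel_op (green l) f) n) UNIV"
      unfolding H by simp
    moreover have "((\<lambda>m. if m = n then l * f n else 0) has_sum l * f n) UNIV"
      by (rule has_sum_finite_neutralI[of "{n}"]) auto
    ultimately have "l * ?H (kernel_op (green l) f) n = l * f n"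
      using has_sum_unique by blast
    then show ?thesis using l by simp
  qed
  then show ?thesis
    unfolding resolvent_def by (intro the_inv_into_f_eq[OF inj _ mem]) auto
qed

end


section \<open>Generic potentials\<close>

text \<open>Powers of 1 + m^2: the factor |n - m| costs 1/2 and the pointwise bound on u costs
  \<sigma>/2. Together (\<sigma> + 1)/2 \<le> (2 \<sigma> - 1)/2, because \<sigma> \<ge> 2.\<close>

lemma T0_summable_of_weighted_l2:
  assumes \<sigma>: "\<sigma> > 5/2" and V: "V \<in> weighted_l1 (2 * \<sigma> - 1)" and u: "u \<in> weighted_l2 (- \<sigma>)"
  shows "T0_summable V u"
  unfolding T0_summable_def
proof (rule allI, rule summable_on_dominated)
  fix n
  let ?N = "l2_norm (- \<sigma>) u"
  let ?w = "\<lambda>m. (1 + (real_of_int m)\<^sup>2)"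
  have "(\<lambda>m. ?w m powr ((2 * \<sigma> - 1) / 2) * norm (V m)) summable_on UNIV"
    using V unfolding weighted_l1_def by blast
  then show "(\<lambda>m. (2 * bracket n * ?N) * (?w m powr ((2 * \<sigma> - 1) / 2) * norm (V m))) summable_on UNIV"
    by (rule summable_on_cmult_right)
  fix m
  have w: "1 \<le> ?w m" by simp
  have um: "cmod (u m) \<le> ?N * ?w m powr (\<sigma> / 2)"
  proof -
    have "?w m powr (\<sigma> / 2) * (?w m powr (- \<sigma> / 2) * cmod (u m)) \<le> ?w m powr (\<sigma> / 2) * ?N"
      using weighted_l2_pointwise[OF u, of m] unfolding weighted_abs_def by (rule mult_left_mono) simp
    moreover have "?w m powr (\<sigma> / 2) * ?w m powr (- \<sigma> / 2) = 1"
      using one_plus_square_pos[of m] by (simp flip: powr_add)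
    ultimately show ?thesis by (simp only: mult.assoc[symmetric] mult.commute[of ?N] mult_1_left)
  qed
  have "bracket m \<le> 2 * ?w m powr (1/2)"
  proof (rule power2_le_imp_le)
    show "(bracket m)\<^sup>2 \<le> (2 * ?w m powr (1/2))\<^sup>2"
      using bracket_square_le[of m] one_plus_square_pos[of m]
      by (simp only: power_mult_distrib powr_half_sqrt[OF less_imp_le] real_sqrt_pow2[OF less_imp_le]) simp
  qed simp
  then have "\<bar>real_of_int (n - m)\<bar> \<le> bracket n * (2 * ?w m powr (1/2))"
    by (intro order.trans[OF abs_diff_le_bracket] mult_left_mono bracket_nonneg)
  then have "\<bar>real_of_int (n - m)\<bar> * \<bar>V m\<bar> * cmod (u m)
      \<le> bracket n * (2 * ?w m powr (1/2)) * \<bar>V m\<bar> * (?N * ?w m powr (\<sigma> / 2))"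
    by (intro mult_mono um) (auto simp: l2_norm_nonneg)
  also have "\<dots> = (2 * bracket n * ?N) * (?w m powr ((\<sigma> + 1) / 2) * \<bar>V m\<bar>)"
  proof -
    have "(\<sigma> + 1) / 2 = 1 / 2 + \<sigma> / 2" by simp
    then have "?w m powr ((\<sigma> + 1) / 2) = ?w m powr (1/2) * ?w m powr (\<sigma> / 2)"
      by (simp only: powr_add)
    then show ?thesis by (simp only: mult_ac)
  qed
  also have "\<dots> \<le> (2 * bracket n * ?N) * (?w m powr ((2 * \<sigma> - 1) / 2) * \<bar>V m\<bar>)"
    using \<sigma> w by (intro mult_left_mono mult_right_mono powr_mono) (auto simp: l2_norm_nonneg)
  finally show "norm (cmod (complex_of_real (\<bar>real_of_int (n - m)\<bar> * V m) * u m))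
      \<le> (2 * bracket n * ?N) * (?w m powr ((2 * \<sigma> - 1) / 2) * norm (V m))"
    by (simp add: norm_mult abs_mult)
qed

lemma T0_diff:
  assumes "T0_summable V u" "T0_summable V v"
  shows "T0_summable V (\<lambda>n. u n - v n)" and "T0 V (\<lambda>n. u n - v n) = (\<lambda>n. T0 V u n - T0 V v n)"
proof -
  let ?k = "\<lambda>u n m. complex_of_real (\<bar>real_of_int (n - m)\<bar> * V m) * u m"
  have a: "(\<lambda>m. cmod (?k u n m)) summable_on UNIV" "(\<lambda>m. cmod (?k v n m)) summable_on UNIV" for n
    using assms unfolding T0_summable_def by blast+
  have s: "?k u n summable_on UNIV" "?k v n summable_on UNIV" for n
    by (rule abs_summable_summable, rule a)+
  have eq: "?k (\<lambda>n. u n - v n) n = (\<lambda>m. ?k u n m - ?k v n m)" for n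
    by (simp add: right_diff_distrib)
  show "T0 V (\<lambda>n. u n - v n) = (\<lambda>n. T0 V u n - T0 V v n)"
    unfolding T0_def eq infsum_diff[OF s] by (simp add: algebra_simps)
  show "T0_summable V (\<lambda>n. u n - v n)"
    unfolding T0_summable_def
  proof (rule allI, rule summable_on_dominated)
    fix n
    show "(\<lambda>m. cmod (?k u n m) + cmod (?k v n m)) summable_on UNIV"
      by (intro summable_on_add a)
    show "norm (cmod (?k (\<lambda>n. u n - v n) n m)) \<le> cmod (?k u n m) + cmod (?k v n m)" for m
      unfolding right_diff_distrib real_norm_def abs_norm_cancel by (rule norm_triangle_ineq4)
  qed
qed

lemma T0_cmult: "T0 V (\<lambda>n. c * u n) = (\<lambda>n. c * T0 V u n)"
  by (simp add: T0_def right_diff_distrib mult.left_commute infsum_cmult_right')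

text \<open>Serves to evaluate the \<open>the_inv_into\<close> in \<open>generic_potential\<close>:
  by injectivity any explicit preimage of the constant 1 is its value. Triviality of the kernel is
  used at s = \<sigma>.\<close>

lemma generic_T0_inj:
  assumes \<sigma>: "\<sigma> > 5/2" and V: "V \<in> weighted_l1 (2 * \<sigma> - 1)" and gen: "generic_potential \<sigma> V"
  shows "inj_on (T0 V) (weighted_l2 (- \<sigma>))"
proof (rule inj_onI)
  fix u v assume u: "u \<in> weighted_l2 (- \<sigma>)" and v: "v \<in> weighted_l2 (- \<sigma>)" and eq: "T0 V u = T0 V v"
  note s = T0_summable_of_weighted_l2[OF \<sigma> V]
  have "(\<lambda>n. u n - v n) \<in> weighted_l2 (- \<sigma>)" by (rule weighted_l2_diff(1)[OF u v])
  moreover have "T0_summable V (\<lambda>n. u n - v n)" "T0 V (\<lambda>n. u n - v n) = (\<lambda>_. 0)"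
    using T0_diff[OF s[OF u] s[OF v]] eq by simp_all
  moreover have "\<sigma> > 3/2" using \<sigma> by simp
  ultimately have "(\<lambda>n. u n - v n) = (\<lambda>_. 0)" using gen unfolding generic_potential_def by blast
  then show "u = v" by (metis eq_iff_diff_eq_0 ext)
qed

section \<open>Nonvanishing of the Wronskian at the threshold\<close>

context jost_pair
begin

lemma solution_zero:
  fixes x :: "int \<Rightarrow> complex"
  assumes rec: "\<And>n. x (n + 1) + x (n - 1) = (2 + of_real (V n)) * x n" and "x 0 = 0" "x 1 = 0"
  shows "x n = 0"
proof -
  have "x n = 0 \<and> x (n + 1) = 0"
  proof (induction n rule: int_induct[of _ 0])
    case (step1 i)
    then show ?case using rec[of "i + 1"] by (simp add: add.commute)
  next
    case (step2 i)
    then show ?case using rec[of i] by simp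
  qed (use assms in simp)
  then show ?thesis by blast
qed

lemma volterra_summable:
  assumes "\<And>m. cmod (x m) \<le> C * bracket m"
  shows "(\<lambda>m. of_nat (nat (m - n)) * of_real (V m) * x m) summable_on UNIV"
    and "(\<lambda>m. of_nat (nat (n - m)) * of_real (V m) * x m) summable_on UNIV"
    and "(\<lambda>m. of_real (V m) * x m) summable_on UNIV"
proof -
  have s: "(\<lambda>m. (C * bracket n) * (bracket m ^ 2 * \<bar>V m\<bar>)) summable_on UNIV"
    by (rule summable_on_cmult_right[OF summable_V_bracket]) simp
  have le: "cmod (a * of_real (V m) * x m) \<le> (C * bracket n) * (bracket m ^ 2 * \<bar>V m\<bar>)"
    if a: "cmod a \<le> bracket n * bracket m" for a :: complex and m
  proof -
    have "cmod a * \<bar>V m\<bar> * cmod (x m) \<le> (bracket n * bracket m) * \<bar>V m\<bar> * (C * bracket m)"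
      by (intro mult_mono a assms) auto
    then show ?thesis by (simp add: norm_mult power2_eq_square mult_ac)
  qed
  show "(\<lambda>m. of_nat (nat (m - n)) * of_real (V m) * x m) summable_on UNIV"
    by (rule summable_on_dominated[OF s]) (rule le, use nat_diff_le_bracket[of _ n] in simp)
  show "(\<lambda>m. of_nat (nat (n - m)) * of_real (V m) * x m) summable_on UNIV"
    by (rule summable_on_dominated[OF s])
       (rule le, use nat_diff_le_bracket[of n] in \<open>simp add: mult.commute\<close>)
  have "1 \<le> bracket n * bracket m" for m
    using mult_mono[OF bracket_ge_1[of n] bracket_ge_1[of m]] by simp
  then have "(\<lambda>m. 1 * of_real (V m) * x m) summable_on UNIV"
    by (intro summable_on_dominated[OF s] le) simp
  then show "(\<lambda>m. of_real (V m) * x m) summable_on UNIV" by simp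
qed

text \<open>If the Jost solutions at the threshold were proportional, the mean of their two Volterra
  equations would say that \<open>T0\<close> maps \<open>g 1\<close> to a constant, and the difference of these equations
  that \<open>V\<close> is orthogonal to \<open>g 1\<close>; each value of the constant is excluded by genericity.\<close>

lemma wronskian_one_nonzero:
  assumes \<sigma>: "\<sigma> > 5/2" and V: "V \<in> weighted_l1 (2 * \<sigma> - 1)" and gen: "generic_potential \<sigma> V"
  shows "wronskian 1 \<noteq> 0"
proof
  assume W: "wronskian 1 = 0"
  have one: "cmod (1::complex) \<le> 1" by simp
  have rec: "g 1 (n + 1) + g 1 (n - 1) = (2 + of_real (V n)) * g 1 n"
    "h 1 (n + 1) + h 1 (n - 1) = (2 + of_real (V n)) * h 1 n" for n
    using g_rec[OF one, of n] h_rec[OF one, of n] by (simp_all add: add.commute)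
  have W': "g 1 0 * h 1 1 = g 1 1 * h 1 0" using W by (simp add: wronskian_def)
  have h0: "h 1 0 \<noteq> 0 \<or> h 1 1 \<noteq> 0"
  proof (rule ccontr)
    assume "\<not> (h 1 0 \<noteq> 0 \<or> h 1 1 \<noteq> 0)"
    then have "h 1 n = 0" for n using solution_zero[of "h 1", OF rec(2)] by blast
    then show False using h_volterra[of 0] by simp
  qed
  \<comment> \<open>The initial data of g and h have zero determinant and those of h are nonzero,
    hence proportionality.\<close>
  obtain c where c: "g 1 0 = c * h 1 0" "g 1 1 = c * h 1 1"
  proof (cases "h 1 0 = 0")
    case False
    then show thesis using W' by (intro that[of "g 1 0 / h 1 0"]) (simp_all add: field_simps)
  next
    case True
    then show thesis using W' h0 by (intro that[of "g 1 1 / h 1 1"]) (simp_all add: field_simps)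
  qed
  have gh: "g 1 n = c * h 1 n" for n
  proof -
    have "g 1 n - c * h 1 n = 0"
    proof (rule solution_zero[of "\<lambda>n. g 1 n - c * h 1 n"])
      fix n
      show "g 1 (n + 1) - c * h 1 (n + 1) + (g 1 (n - 1) - c * h 1 (n - 1))
          = (2 + of_real (V n)) * (g 1 n - c * h 1 n)"
        using rec[of n] by algebra
    qed (use c in auto)
    then show ?thesis by simp
  qed
  note sums = volterra_summable[of "g 1", OF g_bound[OF one]]
  let ?R = "\<lambda>n m. of_nat (nat (m - n)) * of_real (V m) * g 1 m"
  let ?L = "\<lambda>n m. of_nat (nat (n - m)) * of_real (V m) * g 1 m"
  have R: "g 1 n = 1 + infsum (?R n) UNIV" for n by (rule g_volterra)
  \<comment> \<open>The left Volterra equation for h, multiplied by c: thus g satisfies both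
    equations, with constants 1 and c.\<close>
  have L: "g 1 n = c + infsum (?L n) UNIV" for n
  proof -
    have "infsum (?L n) UNIV = c * (\<Sum>\<^sub>\<infinity>m. of_nat (nat (n - m)) * of_real (V m) * h 1 m)"
      unfolding infsum_cmult_right'[symmetric] by (simp add: gh mult_ac)
    then show ?thesis using h_volterra[of n] gh[of n] by (simp add: distrib_left)
  qed
  have T: "T0 V (g 1) n = (1 + c) / 2" for n
  proof -
    have "complex_of_real (\<bar>real_of_int (n - m)\<bar> * V m) * g 1 m = ?R n m + ?L n m" for m
    proof -
      have "\<bar>real_of_int (n - m)\<bar> = real (nat (m - n)) + real (nat (n - m))" by linarith
      then show ?thesis by (simp only: of_real_mult of_real_add of_real_of_nat_eq distrib_right)
    qed
    then have "(\<Sum>\<^sub>\<infinity>m. complex_of_real (\<bar>real_of_int (n - m)\<bar> * V m) * g 1 m)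
        = infsum (?R n) UNIV + infsum (?L n) UNIV"
      by (simp only: infsum_add[OF sums(1,2)])
    also have "\<dots> = 2 * g 1 n - (1 + c)"
    proof -
      have "y + x = 2 * a - (1 + c)" if "a = 1 + y" "a = c + x" for a x y using that by algebra
      from this[OF R L] show ?thesis .
    qed
    finally have S: "(\<Sum>\<^sub>\<infinity>m. complex_of_real (\<bar>real_of_int (n - m)\<bar> * V m) * g 1 m) = 2 * g 1 n - (1 + c)" .
    show ?thesis unfolding T0_def S by (simp add: field_simps)
  qed
  have orth: "(\<Sum>\<^sub>\<infinity>m. of_real (V m) * g 1 m) = 0"
  proof -
    have eq: "of_int (n - m) * of_real (V m) * g 1 m = ?L n m - ?R n m" for n m
    proof -
      have "of_int (n - m) = (of_nat (nat (n - m)) - of_nat (nat (m - n)) :: complex)"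
        by (cases "m \<le> n") simp_all
      then show ?thesis by (simp only: left_diff_distrib)
    qed
    \<comment> \<open>The value does not depend on n, so subtracting the cases n = 0 and n = 1
      leaves the pairing of V with g.\<close>
    have D: "(\<Sum>\<^sub>\<infinity>m. of_int (n - m) * of_real (V m) * g 1 m) = 1 - c" for n
    proof -
      have "x - y = 1 - c" if "a = 1 + y" "a = c + x" for a x y using that by algebra
      from this[OF R L] show ?thesis unfolding eq infsum_diff[OF sums(2,1)] .
    qed
    have s: "(\<lambda>m. of_int (n - m) * of_real (V m) * g 1 m) summable_on UNIV" for n
      unfolding eq by (rule summable_on_diff[OF sums(2,1)])
    have "(\<Sum>\<^sub>\<infinity>m. of_real (V m) * g 1 m)
        = (\<Sum>\<^sub>\<infinity>m. of_int (1 - m) * of_real (V m) * g 1 m - of_int (0 - m) * of_real (V m) * g 1 m)"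
      by (rule infsum_cong) (simp add: left_diff_distrib)
    also have "\<dots> = 0" unfolding infsum_diff[OF s s] D by simp
    finally show ?thesis .
  qed
  have g_mem: "g 1 \<in> weighted_l2 (- \<sigma>)"
  proof (rule weighted_l2_of_growth(1)[OF \<sigma>])
    fix n
    have "C * bracket n \<le> C * (bracket n)\<^sup>2"
      using C_pos bracket_power_mono[of 1 2 n] by (intro mult_left_mono) auto
    then show "cmod (g 1 n) \<le> C * (bracket n)\<^sup>2" using g_bound[OF one, of n] by linarith
  qed
  have g_nz: "g 1 \<noteq> (\<lambda>_. 0)"
  proof
    assume z: "g 1 = (\<lambda>_. 0)"
    show False using g_volterra[of 0] unfolding z by simp
  qed
  show False
  proof (cases "1 + c = 0")
    case True
    then have "T0 V (g 1) = (\<lambda>_. 0)" using T by auto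
    moreover have "\<sigma> > 3/2" using \<sigma> by simp
    ultimately show False
      using gen g_mem g_nz T0_summable_of_weighted_l2[OF \<sigma> V g_mem]
      unfolding generic_potential_def by blast
  next
    case False
    \<comment> \<open>This multiple of g is the inverse image of 1 under \<open>T0\<close>, and V is
      orthogonal to it.\<close>
    let ?a = "2 / (1 + c)"
    have "T0 V (\<lambda>n. ?a * g 1 n) = (\<lambda>_. 1)"
    proof -
      have "2 / x * (x / 2) = 1" if "x \<noteq> 0" for x :: complex using that by simp
      from this[OF False] show ?thesis unfolding T0_cmult T by (rule ext)
    qed
    then have "the_inv_into (weighted_l2 (- \<sigma>)) (T0 V) (\<lambda>_. 1) = (\<lambda>n. ?a * g 1 n)"
      by (rule the_inv_into_f_eq[OF generic_T0_inj[OF \<sigma> V gen] _ weighted_l2_cmult(1)[OF g_mem]])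
    then have "(\<Sum>\<^sub>\<infinity>n. of_real (V n) * the_inv_into (weighted_l2 (- \<sigma>)) (T0 V) (\<lambda>_. 1) n)
        = (\<Sum>\<^sub>\<infinity>n. ?a * (of_real (V n) * g 1 n))"
      by (simp add: mult_ac)
    also have "\<dots> = 0" unfolding infsum_cmult_right' orth by simp
    finally show False using gen unfolding generic_potential_def by blast
  qed
qed

end

section \<open>The expansion at the threshold\<close>

text \<open>The roots of x^2 - (2 - z) x + 1 have product 1. If one lay on the unit circle, the
  other would be its conjugate and their sum 2 - z would be real; so one lies strictly inside. For
  it (1 - l)^2 = -l z.\<close>

lemma spectral_parameter_exists:
  fixes z :: complex
  assumes "0 < Im z"
  obtains l where "cmod l < 1" "l \<noteq> 0" "l\<^sup>2 + 1 = l * (2 - z)" "cmod (1 - l) \<le> sqrt (cmod z)"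
proof -
  let ?b = "(2 - z) / 2"
  obtain s where s: "s\<^sup>2 = ?b\<^sup>2 - 1" using power2_csqrt by blast
  define p q where "p = ?b + s" and "q = ?b - s"
  have pq: "p * q = 1" using s by (simp add: p_def q_def algebra_simps power2_eq_square)
  have sum: "p + q = 2 - z" by (simp add: p_def q_def)
  have root: "x\<^sup>2 + 1 = x * (2 - z)" if "x = p \<or> x = q" for x
  proof -
    have "p\<^sup>2 + p * q = p * (p + q)" "q\<^sup>2 + p * q = q * (p + q)"
      by (simp_all add: power2_eq_square algebra_simps)
    then show ?thesis using that unfolding pq sum by blast
  qed
  have nz: "p \<noteq> 0" "q \<noteq> 0" using pq by auto
  have norm: "cmod p * cmod q = 1" using pq by (metis norm_mult norm_one)
  have "cmod p \<noteq> 1"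
  proof
    assume p1: "cmod p = 1"
    have "q = cnj p"
      using pq nz p1 complex_norm_square[of p] by (metis mult_cancel_left of_real_1 one_power2)
    then have "Im (p + q) = 0" by simp
    then show False using assms unfolding sum by simp
  qed
  then have "cmod p < 1 \<or> cmod q < 1"
    using norm by (smt (verit) mult_le_cancel_left1 mult_less_cancel_left1 norm_ge_zero)
  then obtain l where l: "l = p \<or> l = q" "cmod l < 1" by blast
  have "(1 - l)\<^sup>2 = - (l * z)"
    using root[OF l(1)] by (simp add: power2_eq_square algebra_simps)
  then have "(cmod (1 - l))\<^sup>2 = cmod l * cmod z"
    by (metis norm_minus_cancel norm_mult norm_power)
  also have "\<dots> \<le> cmod z" using l(2) mult_right_mono[of "cmod l" 1 "cmod z"] by simp
  finally have "cmod (1 - l) \<le> sqrt (cmod z)" by (rule real_le_rsqrt)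
  with l nz root show thesis by (intro that[of l]) auto
qed

text \<open>With G the Green operator, A - G(1) is (G(l) - G(1)) - (G(l) - A), and G(l) is the
  resolvent at z. The kernel estimate bounds the first part, the operator norm the second.\<close>

lemma (in jost_pair) op_norm_boundary_le:
  assumes \<sigma>: "\<sigma> > 5/2" and A: "A \<in> bounded_ops \<sigma> (- \<sigma>)"
    and l: "cmod l < 1" "l \<noteq> 0" "l\<^sup>2 + 1 = l * (2 - z)" and W: "wronskian l \<noteq> 0"
    and diff: "\<And>n m. cmod (green l n m - green 1 n m) \<le> D * (bracket n)\<^sup>2 * (bracket m)\<^sup>2"
  shows "op_norm \<sigma> (- \<sigma>) (op_diff A (kernel_op (green 1)))
    \<le> op_norm \<sigma> (- \<sigma>) (op_diff (resolvent V z) A) + D * (moment_const \<sigma>)\<^sup>2"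
proof (rule op_norm_least)
  have l1: "cmod l \<le> 1" "cmod (1::complex) \<le> 1" using l by simp_all
  interpret K: bounded_kernel \<sigma> "green l" "C\<^sup>2 / cmod (wronskian l)"
    by (rule green_bounded_kernel[OF l1(1) \<sigma>])
  interpret K1: bounded_kernel \<sigma> "green 1" "C\<^sup>2 / cmod (wronskian 1)"
    by (rule green_bounded_kernel[OF l1(2) \<sigma>])
  interpret E: bounded_kernel \<sigma> "\<lambda>n m. green l n m - green 1 n m" D
    by unfold_locales (use \<sigma> diff in auto)
  let ?R = "op_diff (resolvent V z) A"
  have A_mem: "A u \<in> weighted_l2 (- \<sigma>)" if "u \<in> weighted_l2 \<sigma>" for u
    using A that by (auto simp: bounded_ops_def)
  obtain B where B: "\<And>u. u \<in> weighted_l2 \<sigma> \<Longrightarrow> l2_norm (- \<sigma>) (A u) \<le> B * l2_norm \<sigma> u"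
  proof -
    have "\<exists>B. \<forall>u\<in>weighted_l2 \<sigma>. l2_norm (- \<sigma>) (A u) \<le> B * l2_norm \<sigma> u"
      using A unfolding bounded_ops_def by blast
    then show thesis using that by blast
  qed
  have R: "?R u = (\<lambda>n. kernel_op (green l) u n - A u n)" if "u \<in> weighted_l2 \<sigma>" for u
    using resolvent_eq_green[OF l W \<sigma> that] by (simp add: op_diff_def)
  have R_bdd: "?R u \<in> weighted_l2 (- \<sigma>) \<and>
      l2_norm (- \<sigma>) (?R u) \<le> (C\<^sup>2 / cmod (wronskian l) * (moment_const \<sigma>)\<^sup>2 + B) * l2_norm \<sigma> u"
    if u: "u \<in> weighted_l2 \<sigma>" for u
    unfolding R[OF u]
    using weighted_l2_diff[OF K.kernel_op_weighted[OF u] A_mem[OF u]] K.kernel_op_norm_le[OF u] B[OF u]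
    by (simp add: distrib_right)
  have R_le: "l2_norm (- \<sigma>) (?R u) \<le> op_norm \<sigma> (- \<sigma>) ?R * l2_norm \<sigma> u" if "u \<in> weighted_l2 \<sigma>" for u
    by (rule op_norm_upper[OF _ that]) (rule R_bdd)
  have E_eq: "kernel_op (\<lambda>n m. green l n m - green 1 n m) u
      = (\<lambda>n. kernel_op (green l) u n - kernel_op (green 1) u n)" if "u \<in> weighted_l2 \<sigma>" for u
    using K.kernel_summable[OF that] K1.kernel_summable[OF that]
    by (simp add: kernel_op_def left_diff_distrib infsum_diff)
  show "l2_norm (- \<sigma>) (op_diff A (kernel_op (green 1)) u)
      \<le> (op_norm \<sigma> (- \<sigma>) ?R + D * (moment_const \<sigma>)\<^sup>2) * l2_norm \<sigma> u"
    if u: "u \<in> weighted_l2 \<sigma>" for u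
  proof -
    let ?E = "kernel_op (\<lambda>n m. green l n m - green 1 n m) u"
    have "op_diff A (kernel_op (green 1)) u = (\<lambda>n. ?E n - ?R u n)"
      unfolding R[OF u] E_eq[OF u] by (simp add: op_diff_def)
    then have "l2_norm (- \<sigma>) (op_diff A (kernel_op (green 1)) u) \<le> l2_norm (- \<sigma>) ?E + l2_norm (- \<sigma>) (?R u)"
      using weighted_l2_diff(2)[OF E.kernel_op_weighted[OF u]] R_bdd[OF u] by simp
    also have "\<dots> \<le> D * (moment_const \<sigma>)\<^sup>2 * l2_norm \<sigma> u + op_norm \<sigma> (- \<sigma>) ?R * l2_norm \<sigma> u"
      by (intro add_mono E.kernel_op_norm_le[OF u] R_le u)
    finally show ?thesis by (simp add: algebra_simps)
  qed
  have "0 \<le> op_norm \<sigma> (- \<sigma>) ?R"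
  proof -
    \<comment> \<open>A sequence of positive norm, on which the upper bound forces the operator norm
      to be nonnegative.\<close>
    let ?\<delta> = "\<lambda>n::int. if n = 0 then 1 else 0 :: complex"
    have \<delta>: "?\<delta> \<in> weighted_l2 \<sigma>"
      unfolding weighted_l2_def mem_Collect_eq
      by (rule has_sum_imp_summable, rule has_sum_finite_neutralI[of "{0}"]) auto
    have "l2_norm \<sigma> ?\<delta> \<noteq> 0" using l2_norm_eq_0D[OF \<delta>, of 0] by auto
    then have "0 < l2_norm \<sigma> ?\<delta>" using l2_norm_nonneg[of \<sigma> ?\<delta>] by linarith
    moreover have "0 \<le> op_norm \<sigma> (- \<sigma>) ?R * l2_norm \<sigma> ?\<delta>"
      using R_le[OF \<delta>] l2_norm_nonneg order.trans by blast
    ultimately show ?thesis by (simp add: zero_le_mult_iff)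
  qed
  then show "0 \<le> op_norm \<sigma> (- \<sigma>) ?R + D * (moment_const \<sigma>)\<^sup>2"
    using E.B_nonneg by simp
qed

theorem theorem2:
  fixes \<sigma> :: real and V :: "int \<Rightarrow> real" and R :: "real \<Rightarrow> seq_op"
  assumes "\<sigma> > 5/2"
    and "V \<in> weighted_l1 (2 * \<sigma> - 1)"
    and "generic_potential \<sigma> V"
    and "\<And>\<omega>. 0 < \<omega> \<Longrightarrow> \<omega> < 4 \<Longrightarrow> is_boundary_resolvent \<sigma> V \<omega> (R \<omega>)"
  shows "\<exists>R0 \<in> bounded_ops \<sigma> (- \<sigma>). \<exists>C>0. \<exists>\<omega>0>0. \<forall>\<omega>. 0 < \<omega> \<and> \<omega> < \<omega>0 \<longrightarrow>
           op_norm \<sigma> (- \<sigma>) (op_diff (R \<omega>) R0) \<le> C * sqrt \<omega>"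
proof -
  interpret decaying_potential V
    by (rule decaying_potential_of_weighted_l1[OF assms(1,2)])
  obtain g h C where "jost_pair V g h C" using jost_pair_exists by blast
  then interpret J: jost_pair V g h C .
  obtain \<delta> D where \<delta>: "0 < \<delta>" and D: "0 < D"
    and green: "\<And>l n m. cmod l \<le> 1 \<Longrightarrow> cmod (1 - l) < \<delta> \<Longrightarrow> J.wronskian l \<noteq> 0 \<and>
      cmod (J.green l n m - J.green 1 n m) \<le> D * cmod (1 - l) * (bracket n)\<^sup>2 * (bracket m)\<^sup>2"
    using J.green_diff[OF J.wronskian_one_nonzero[OF assms(1-3)]] by metis
  interpret K: bounded_kernel \<sigma> "J.green 1" "C\<^sup>2 / cmod (J.wronskian 1)"
    by (rule J.green_bounded_kernel) (use assms(1) in auto)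
  let ?M = "(moment_const \<sigma>)\<^sup>2"
  \<comment> \<open>The bound \<delta>^2 on \<omega> matches |1 - l| \<le> sqrt |z|, and 4 is the
    end of the range where R(\<omega>) is given. The added 1 makes the constant positive without a
    lower bound on the moment constant.\<close>
  have bound: "op_norm \<sigma> (- \<sigma>) (op_diff (R \<omega>) (kernel_op (J.green 1))) \<le> (D * ?M + 1) * sqrt \<omega>"
    if \<omega>: "0 < \<omega>" "\<omega> < min 4 (\<delta>\<^sup>2)" for \<omega>
  proof -
    have R: "R \<omega> \<in> bounded_ops \<sigma> (- \<sigma>)"
      and lim: "((\<lambda>\<epsilon>. op_norm \<sigma> (- \<sigma>) (op_diff (resolvent V (Complex \<omega> \<epsilon>)) (R \<omega>))) \<longlongrightarrow> 0) (at_right 0)"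
      using assms(4)[of \<omega>] \<omega> by (auto simp: is_boundary_resolvent_def)
    have "((\<lambda>\<epsilon>. sqrt (\<omega>\<^sup>2 + \<epsilon>\<^sup>2)) \<longlongrightarrow> sqrt (\<omega>\<^sup>2 + 0\<^sup>2)) (at_right 0)"
      by (intro tendsto_intros)
    then have norm_lim: "((\<lambda>\<epsilon>. cmod (Complex \<omega> \<epsilon>)) \<longlongrightarrow> \<omega>) (at_right 0)"
      using \<omega>(1) by (simp add: cmod_def)
    then have "\<forall>\<^sub>F \<epsilon> in at_right 0. cmod (Complex \<omega> \<epsilon>) < \<delta>\<^sup>2"
      using \<omega>(2) by (intro order_tendstoD(2)) auto
    then have "\<forall>\<^sub>F \<epsilon> in at_right 0. op_norm \<sigma> (- \<sigma>) (op_diff (R \<omega>) (kernel_op (J.green 1)))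
        \<le> op_norm \<sigma> (- \<sigma>) (op_diff (resolvent V (Complex \<omega> \<epsilon>)) (R \<omega>))
          + D * sqrt (cmod (Complex \<omega> \<epsilon>)) * ?M"
      using eventually_at_right_less
    proof eventually_elim
      \<comment> \<open>The parameter l is chosen separately for each \<epsilon>; only the bound on
        |1 - l| is carried to the limit.\<close>
      case (elim \<epsilon>)
      then obtain l where l: "cmod l < 1" "l \<noteq> 0" "l\<^sup>2 + 1 = l * (2 - Complex \<omega> \<epsilon>)"
        and le: "cmod (1 - l) \<le> sqrt (cmod (Complex \<omega> \<epsilon>))"
        using spectral_parameter_exists[of "Complex \<omega> \<epsilon>"] by auto
      have "sqrt (cmod (Complex \<omega> \<epsilon>)) < \<delta>" using elim(1) \<delta> by (simp add: real_less_lsqrt)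
      then have lt: "cmod (1 - l) < \<delta>" using le by linarith
      have l1: "cmod l \<le> 1" using l by simp
      show ?case
      proof (rule J.op_norm_boundary_le[OF assms(1) R l])
        show "J.wronskian l \<noteq> 0" using green[OF l1 lt] by blast
        fix n m
        have "D * cmod (1 - l) * (bracket n)\<^sup>2 * (bracket m)\<^sup>2
            \<le> D * sqrt (cmod (Complex \<omega> \<epsilon>)) * (bracket n)\<^sup>2 * (bracket m)\<^sup>2"
          by (intro mult_right_mono mult_left_mono le) (use D in auto)
        with green[OF l1 lt, of n m]
        show "cmod (J.green l n m - J.green 1 n m) \<le> D * sqrt (cmod (Complex \<omega> \<epsilon>)) * (bracket n)\<^sup>2 * (bracket m)\<^sup>2"
          by linarith
      qed
    qed
    moreover have "((\<lambda>\<epsilon>. op_norm \<sigma> (- \<sigma>) (op_diff (resolvent V (Complex \<omega> \<epsilon>)) (R \<omega>))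
        + D * sqrt (cmod (Complex \<omega> \<epsilon>)) * ?M) \<longlongrightarrow> 0 + D * sqrt \<omega> * ?M) (at_right 0)"
      by (intro tendsto_intros lim norm_lim)
    \<comment> \<open>The left side is independent of \<epsilon>; on the right the resolvent term
      vanishes by the definition of R(\<omega>), and |z| tends to \<omega>.\<close>
    ultimately have "op_norm \<sigma> (- \<sigma>) (op_diff (R \<omega>) (kernel_op (J.green 1))) \<le> 0 + D * sqrt \<omega> * ?M"
      by (intro tendsto_lowerbound) auto
    also have "\<dots> \<le> (D * ?M + 1) * sqrt \<omega>" using \<omega>(1) by (simp add: algebra_simps)
    finally show ?thesis .
  qed
  show ?thesis
  proof (intro bexI exI conjI allI impI)
    show "kernel_op (J.green 1) \<in> bounded_ops \<sigma> (- \<sigma>)" by (rule K.kernel_op_bounded)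
    show "0 < D * ?M + 1" using D by (simp add: add_nonneg_pos)
    show "0 < min 4 (\<delta>\<^sup>2)" using \<delta> by simp
  qed (use bound in blast)
qed

end
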